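(* Let $\varepsilon>0$ and let $f\in L^1_2(\mathbb{R}^3)\setminus\{0\}$ be nonnegative and such that $$1-\varepsilon f>0\qquad\text{and}\qquad \frac{f}{1-\varepsilon f}\in L^1_2(\mathbb{R}^3)\cap L\log L(\mathbb{R}^3).$$ Then $$H_0\left[\left.\frac{f}{1-\varepsilon f}\right|M^{\frac{f}{1-\varepsilon f}}\right]\ \geq\ H_\varepsilon\left[f\,|\,\mathcal{M}_\varepsilon^f\right].$$
   Context: For $p\ge 1$, $s\in\mathbb{R}$: $\|g\|_{L^p_s}:=\left(\int_{\mathbb{R}^3}|g(v)|^p(1+|v|^2)^{ps/2}\,dv\right)^{1/p}$, and $L^p_s(\mathbb{R}^3)$ is the set of measurable $g$ with finite norm. $L\log L(\mathbb{R}^3)$: measurable $g$ with $g\log|g|$ integrable ($0\log 0=0$). Moments: for nonnegative $f\in L^1_2(\mathbb{R}^3)\setminus\{0\}$, $(\rho,u,T)\in(0,\infty)\times\mathbb{R}^3\times(0,\infty)$ are defined by $\int f\,dv=\rho$, $\int f v\,dv=\rho u$, $\int f|v|^2\,dv=3\rho T+\rho|u|^2$. Equilibria: for $\varepsilon\ge0$, an $\varepsilon$-Fermi-Dirac distribution (Maxwellian if $\varepsilon=0$) is a function $v\mapsto \frac{e^{a+b|v-\bar u|^2}}{1+\varepsilon e^{a+b|v-\bar u|^2}}$ with $a\in\mathbb{R}$, $\bar u\in\mathbb{R}^3$, $b<0$. $\mathcal{M}_\varepsilon^f$ denotes the unique $\varepsilon$-Fermi-Dirac distribution having the same integrals against $1$,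 $v$, $|v|^2$ as $f$; for $\varepsilon>0$ and $1-\varepsilon f\ge 0$ it is known to exist iff $\gamma:=T/T_F(\rho,\varepsilon)>\frac25$, where $T_F(\rho,\varepsilon)=\frac12\left(\frac{3\varepsilon\rho}{4\pi}\right)^{2/3}$; moreover $\gamma\ge\frac25$ always holds, with equality iff $f=\varepsilon^{-1}\mathbf 1_{|\cdot-u|\le(3\varepsilon\rho/4\pi)^{1/3}}$ (so $1-\varepsilon f>0$ implies $\gamma>\frac25$). The Maxwellian associated with $g$ is $M^g:=\mathcal{M}_0^g$. Entropy: $\varphi_\varepsilon(x)=\frac{x}{1-\varepsilon x}$ and $\Phi_\varepsilon(x)=\int_0^x\log\varphi_\varepsilon(y)\,dy$ for $x\ge0$ with $1-\varepsilon x\ge0$ (so $\Phi_0(x)=x\log x-x$ and, for $\varepsilon>0$, $\Phi_\varepsilon(x)=x\log x+\varepsilon^{-1}(1-\varepsilon x)\log(1-\varepsilon x)$). $H_\varepsilon(f)=\int_{\mathbb{R}^3}\Phi_\varepsilon(f(v))\,dv$ and $H_\varepsilon[f|g]=H_\varepsilon(f)-H_\varepsilon(g)$. *)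

theory Defs
  imports "HOL-Analysis.Analysis"
begin

text \<open>
  Elements of the function spaces are represented by functions, so ``$f = 0$'' and pointwise
  inequalities on elements of these spaces are to be read almost everywhere with respect to
  the Lebesgue measure.
\<close>

text \<open>
  For $p \ge 1$ the integrand is nonnegative and measurable, so integrability says exactly
  that the weighted norm is finite.
\<close>

definition Lp_weighted :: "real \<Rightarrow> real \<Rightarrow> (real^3 \<Rightarrow> real) set" where
  "Lp_weighted p s = {g \<in> borel_measurable lebesgue.
     integrable lebesgue (\<lambda>v. \<bar>g v\<bar> powr p * (1 + (norm v)\<^sup>2) powr (p * s / 2))}"

text \<open>The library convention \<^term>\<open>ln (0::real) = 0\<close> gives $0 \log 0 = 0$.\<close>

definition LlogL :: "(real^3 \<Rightarrow> real) set" where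
  "LlogL = {g \<in> borel_measurable lebesgue. integrable lebesgue (\<lambda>v. g v * ln \<bar>g v\<bar>)}"

definition Fermi_Dirac :: "real \<Rightarrow> (real^3 \<Rightarrow> real) set" where
  "Fermi_Dirac \<epsilon> = {M. \<exists>a b u. b < 0 \<and>
     M = (\<lambda>v. exp (a + b * (norm (v - u))\<^sup>2) / (1 + \<epsilon> * exp (a + b * (norm (v - u))\<^sup>2)))}"

definition same_moments :: "(real^3 \<Rightarrow> real) \<Rightarrow> (real^3 \<Rightarrow> real) \<Rightarrow> bool" where
  "same_moments f g \<longleftrightarrow>
     (LINT v|lebesgue. f v) = (LINT v|lebesgue. g v) \<and>
     (LINT v|lebesgue. f v *\<^sub>R v) = (LINT v|lebesgue. g v *\<^sub>R v) \<and>
     (LINT v|lebesgue. f v * (norm v)\<^sup>2) = (LINT v|lebesgue. g v * (norm v)\<^sup>2)"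

definition equilibrium :: "real \<Rightarrow> (real^3 \<Rightarrow> real) \<Rightarrow> real^3 \<Rightarrow> real" where
  "equilibrium \<epsilon> f = (THE M. M \<in> Fermi_Dirac \<epsilon> \<and> same_moments M f)"

definition Maxwellian :: "(real^3 \<Rightarrow> real) \<Rightarrow> real^3 \<Rightarrow> real" where
  "Maxwellian g = equilibrium 0 g"

definition \<phi> :: "real \<Rightarrow> real \<Rightarrow> real" where
  "\<phi> \<epsilon> x = x / (1 - \<epsilon> * x)"

text \<open>
  Only used for \<^term>\<open>x \<ge> 0\<close> with \<^term>\<open>1 - \<epsilon> * x \<ge> 0\<close>. The integrand can be
  singular only at \<^term>\<open>y = 0\<close> and \<^term>\<open>\<epsilon> * y = 1\<close>; its values there do not affect the integral.
\<close>

definition \<Phi> :: "real \<Rightarrow> real \<Rightarrow> real" where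
  "\<Phi> \<epsilon> x = integral {0..x} (\<lambda>y. ln (\<phi> \<epsilon> y))"

definition entropy :: "real \<Rightarrow> (real^3 \<Rightarrow> real) \<Rightarrow> real" where
  "entropy \<epsilon> f = (LINT v|lebesgue. \<Phi> \<epsilon> (f v))"

definition relative_entropy :: "real \<Rightarrow> (real^3 \<Rightarrow> real) \<Rightarrow> (real^3 \<Rightarrow> real) \<Rightarrow> real" where
  "relative_entropy \<epsilon> f g = entropy \<epsilon> f - entropy \<epsilon> g"

lemma continuous_on_x_ln_x: "continuous_on {0..} (\<lambda>x::real. x * ln x)"
proof -
  have "continuous (at x within {0..}) (\<lambda>x::real. x * ln x)" if "x \<ge> 0" for x
  proof (cases "x = 0")
    case True
    have "((\<lambda>x::real. x * ln x) \<longlongrightarrow> 0) (at_right 0)"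
    proof -
      have "((\<lambda>x::real. - (ln x / x)) \<longlongrightarrow> 0) at_top"
        using tendsto_minus[OF ln_x_over_x_tendsto_0] by simp
      moreover have "eventually (\<lambda>x::real. - (ln x / x) = inverse x * ln (inverse x)) at_top"
        using eventually_gt_at_top[of 0] by eventually_elim (simp add: ln_inverse divide_inverse)
      ultimately show ?thesis
        unfolding filterlim_at_right_to_top by (rule Lim_transform_eventually)
    qed
    then show ?thesis using True by (simp add: continuous_within at_within_Ici_at_right)
  next
    case False
    then have "isCont (\<lambda>x::real. x * ln x) x" using that by (intro continuous_intros) auto
    then show ?thesis by (rule continuous_at_imp_continuous_at_within)
  qed
  then show ?thesis by (simp add: continuous_on_eq_continuous_within)
qed

lemma \<Phi>_eq:
  assumes "\<epsilon> > 0" "x \<ge> 0" "1 - \<epsilon> * x \<ge> 0"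
  shows "\<Phi> \<epsilon> x = x * ln x + (1 - \<epsilon> * x) * ln (1 - \<epsilon> * x) / \<epsilon>"
proof -
  let ?F = "\<lambda>x. x * ln x + (1 - \<epsilon> * x) * ln (1 - \<epsilon> * x) / \<epsilon>"
  have less: "1 - \<epsilon> * y > 0" if "y < x" for y
    using assms mult_strict_left_mono[OF that \<open>\<epsilon> > 0\<close>] by linarith
  have cl: "1 - \<epsilon> * y \<ge> 0" if "y \<in> {0..x}" for y
    using less[of y] assms that by (cases "y = x") auto
  have "continuous_on {0..x} (\<lambda>y. (1 - \<epsilon> * y) * ln (1 - \<epsilon> * y))"
    using cl by (intro continuous_on_compose2[OF continuous_on_x_ln_x, of _ "\<lambda>y. 1 - \<epsilon> * y"])
      (auto intro!: continuous_intros)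
  moreover have "continuous_on {0..x} (\<lambda>y. y * ln y)"
    by (rule continuous_on_subset[OF continuous_on_x_ln_x]) auto
  ultimately have cont: "continuous_on {0..x} ?F"
    using assms by (intro continuous_on_add continuous_on_divide continuous_on_const) auto
  have "((\<lambda>y. ln (\<phi> \<epsilon> y)) has_integral (?F x - ?F 0)) {0..x}"
  proof (rule fundamental_theorem_of_calculus_interior[OF assms(2) cont])
    fix y assume y: "y \<in> {0<..<x}"
    then have pos: "y > 0" "1 - \<epsilon> * y > 0" using less by auto
    have "(?F has_real_derivative ln (\<phi> \<epsilon> y)) (at y)"
      using pos assms unfolding \<phi>_def
      by (auto intro!: derivative_eq_intros simp: ln_div divide_simps) (auto simp: algebra_simps)
    then show "(?F has_vector_derivative ln (\<phi> \<epsilon> y)) (at y)"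
      by (simp add: has_real_derivative_iff_has_vector_derivative)
  qed
  then show ?thesis by (simp add: \<Phi>_def integral_unique)
qed

lemma \<Phi>_0_eq:
  assumes "x \<ge> 0"
  shows "\<Phi> 0 x = x * ln x - x"
proof -
  have "continuous_on {0..x} (\<lambda>y. y * ln y)"
    by (rule continuous_on_subset[OF continuous_on_x_ln_x]) auto
  then have cont: "continuous_on {0..x} (\<lambda>y. y * ln y - y)"
    by (intro continuous_on_diff continuous_on_id)
  have "((\<lambda>y. ln (\<phi> 0 y)) has_integral ((x * ln x - x) - (0 * ln 0 - 0))) {0..x}"
  proof (rule fundamental_theorem_of_calculus_interior[OF assms cont])
    fix y assume "y \<in> {0<..<x}"
    then have "((\<lambda>y. y * ln y - y) has_real_derivative ln (\<phi> 0 y)) (at y)"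
      unfolding \<phi>_def by (auto intro!: derivative_eq_intros)
    then show "((\<lambda>y. y * ln y - y) has_vector_derivative ln (\<phi> 0 y)) (at y)"
      by (simp add: has_real_derivative_iff_has_vector_derivative)
  qed
  then show ?thesis by (simp add: \<Phi>_def integral_unique)
qed

end

theory Submission
  imports Defs "HOL-Probability.Distributions"
begin

text \<open>
  Write $g = f/(1-\<epsilon> f) = \varphi_\<epsilon>(f)$, so that $f = g/(1+\<epsilon> g)$, and let $m$ be the Maxwellian
  of $g$. Since $\Phi_\<epsilon>' = \log\varphi_\<epsilon>$, the substitution $t = z/(1+\<epsilon> z)$ turns the Bregman
  divergence of $\Phi_\<epsilon>$ between $x/(1+\<epsilon> x)$ and $y/(1+\<epsilon> y)$ into
  \[ d_\<epsilon>(x,y) = \int_y^x \frac{\log z - \log y}{(1+\<epsilon> z)^2}\,dz . \]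
  The weight $(1+\<epsilon> z)^{-2}$ is at most $1$ and the rest of the integrand has the sign of $x-y$,
  hence $0 \le d_\<epsilon>(x,y) \le d_0(x,y)$ (lemmas bregman_nonneg and bregman_le_boltzmann).

  A function $\mu/(1+\<epsilon>\mu)$ is an $\<epsilon>$-Fermi-Dirac distribution exactly when $\mu$ is a
  decaying Gaussian, that is, when $\log\mu$ is a quadratic polynomial in $v$ of the isotropic form
  $a + b|v-u|^2$. Such polynomials integrate equally against two functions with the same moments, so
  relative entropies with respect to an equilibrium with the right moments are integrals of
  $d_\<epsilon>$ (lemma relative_entropy_eq_bregman). For the same reason the three-point identity
  of Bregman divergences becomes a Pythagorean theorem: replacing $m$ by the Gaussian of
  $\mathcal M_\<epsilon>^f$ can only decrease $\int d_\<epsilon>(g,\cdot)$ (lemma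
  relative_entropy_equilibrium_le). Altogether
  \[ H_0[g|m] = \int d_0(g,m) \ge \int d_\<epsilon>(g,m) \ge H_\<epsilon>[f|\mathcal M_\<epsilon>^f] . \]

  All of this presupposes that both equilibria exist and are unique. Uniqueness is strict
  monotonicity of $x \mapsto x/(1+\<epsilon> x)$ against the same quadratic polynomials. For existence,
  centring and scaling reduce the problem to one scalar equation $I_2(a)^3/I_0(a)^5 = E^3/\rho^5$,
  where $I_k(a)$ are the moments of the profile with exponent $a - |w|^2$, and $\rho$, $E$ are the
  density and the centred energy of the given function. The left-hand side is continuous in $a$,
  unbounded as $a \to -\infty$, and as $a \to \infty$ it drops to $0$ if $\<epsilon> = 0$, and to the ratio of
  the saturated state $\<epsilon>^{-1}\mathbf 1_{B}$ if $\<epsilon> > 0$. By the bathtub principle, $1-\<epsilon> f > 0$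
  places $E^3/\rho^5$ strictly above that last value, and the intermediate value theorem applies.
\<close>

section \<open>The map inverse to \<phi> and its Bregman divergences\<close>

definition fermi :: "real \<Rightarrow> real \<Rightarrow> real" where
  "fermi \<epsilon> x = x / (1 + \<epsilon> * x)"

text \<open>
  An antiderivative of $1/(1+\<epsilon> x)$; it is the part of $\Phi_\<epsilon>(x/(1+\<epsilon> x))$ that does not
  carry the factor $\log x$.
\<close>

definition fermi_primitive :: "real \<Rightarrow> real \<Rightarrow> real" where
  "fermi_primitive \<epsilon> x = (if \<epsilon> = 0 then x else ln (1 + \<epsilon> * x) / \<epsilon>)"

text \<open>
  The Bregman divergence of \<^term>\<open>\<Phi> \<epsilon>\<close> between \<^term>\<open>fermi \<epsilon> x\<close> and \<^term>\<open>fermi \<epsilon> y\<close>, in the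
  variables $x$ and $y$. The slope of \<^term>\<open>\<Phi> \<epsilon>\<close> at \<^term>\<open>fermi \<epsilon> y\<close> is \<^term>\<open>ln y\<close> for
  every \<^term>\<open>\<epsilon>\<close>, so divergences for different \<^term>\<open>\<epsilon>\<close> become comparable.
\<close>

definition bregman :: "real \<Rightarrow> real \<Rightarrow> real \<Rightarrow> real" where
  "bregman \<epsilon> x y =
     fermi \<epsilon> x * (ln x - ln y) - (fermi_primitive \<epsilon> x - fermi_primitive \<epsilon> y)"

lemma one_plus_pos: "0 < 1 + \<epsilon> * x" if "\<epsilon> \<ge> 0" "x \<ge> 0" for \<epsilon> x :: real
  using mult_nonneg_nonneg[OF that] by linarith

lemma fermi_0 [simp]: "fermi 0 x = x"
  by (simp add: fermi_def)

lemma fermi_nonneg: "0 \<le> fermi \<epsilon> x" if "\<epsilon> \<ge> 0" "x \<ge> 0"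
  using that by (simp add: fermi_def)

lemma fermi_pos: "0 < fermi \<epsilon> x" if "\<epsilon> \<ge> 0" "x > 0"
  using that one_plus_pos[of \<epsilon> x] by (simp add: fermi_def)

lemma fermi_le_self: "fermi \<epsilon> x \<le> x" if "\<epsilon> \<ge> 0" "x \<ge> 0"
  using that one_plus_pos[of \<epsilon> x] mult_nonneg_nonneg[of "\<epsilon> * x" x]
  by (simp add: fermi_def divide_le_eq algebra_simps)

lemma fermi_le_inverse: "fermi \<epsilon> x \<le> 1 / \<epsilon>" if "\<epsilon> > 0" "x \<ge> 0"
  using that one_plus_pos[of \<epsilon> x] by (simp add: fermi_def divide_simps)

lemma strict_mono_fermi: "fermi \<epsilon> x < fermi \<epsilon> y" if "\<epsilon> \<ge> 0" "0 \<le> x" "x < y"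
  using that one_plus_pos[of \<epsilon> x] one_plus_pos[of \<epsilon> y]
  by (simp add: fermi_def divide_simps algebra_simps)

lemma fermi_phi: "fermi \<epsilon> (x / (1 - \<epsilon> * x)) = x" if "1 - \<epsilon> * x > 0"
  using that by (simp add: fermi_def field_simps)

lemma borel_measurable_fermi [measurable]: "fermi \<epsilon> \<in> borel_measurable borel"
  unfolding fermi_def[abs_def] by measurable

lemma borel_measurable_fermi_primitive [measurable]: "fermi_primitive \<epsilon> \<in> borel_measurable borel"
  unfolding fermi_primitive_def[abs_def] by measurable

lemma fermi_primitive_bounds:
  assumes "\<epsilon> \<ge> 0" "x \<ge> 0"
  shows "0 \<le> fermi_primitive \<epsilon> x" "fermi_primitive \<epsilon> x \<le> x"
  using assms ln_add_one_self_le_self[of "\<epsilon> * x"]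
  by (auto simp: fermi_primitive_def divide_le_eq mult.commute)

text \<open>
  With $f = x/(1+\<epsilon> x)$ one has $1-\<epsilon> f = 1/(1+\<epsilon> x)$, which collapses the two logarithms of the
  Fermi entropy.
\<close>

lemma Phi_fermi:
  assumes "\<epsilon> \<ge> 0" "x \<ge> 0"
  shows "\<Phi> \<epsilon> (fermi \<epsilon> x) = fermi \<epsilon> x * ln x - fermi_primitive \<epsilon> x"
proof (cases "\<epsilon> = 0")
  case True
  then show ?thesis using assms by (simp add: \<Phi>_0_eq fermi_primitive_def)
next
  case False
  have pos: "1 + \<epsilon> * x > 0" by (rule one_plus_pos[OF assms])
  have vac: "1 - \<epsilon> * fermi \<epsilon> x = 1 / (1 + \<epsilon> * x)"
    using pos by (simp add: fermi_def field_simps)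
  have "\<Phi> \<epsilon> (fermi \<epsilon> x) = fermi \<epsilon> x * ln (fermi \<epsilon> x) - ln (1 + \<epsilon> * x) / ((1 + \<epsilon> * x) * \<epsilon>)"
    using False assms pos by (subst \<Phi>_eq) (auto simp: vac fermi_nonneg ln_div)
  also have "\<dots> = fermi \<epsilon> x * ln x - ln (1 + \<epsilon> * x) / \<epsilon>"
  proof (cases "x = 0")
    case True
    then show ?thesis by (simp add: fermi_def)
  next
    case x: False
    have "ln (fermi \<epsilon> x) = ln x - ln (1 + \<epsilon> * x)"
      using x assms pos by (simp add: fermi_def ln_div)
    moreover have "ln (1 + \<epsilon> * x) / \<epsilon> =
        fermi \<epsilon> x * ln (1 + \<epsilon> * x) + ln (1 + \<epsilon> * x) / ((1 + \<epsilon> * x) * \<epsilon>)"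
    proof -
      define p where "p = 1 + \<epsilon> * x"
      have "x = (p - 1) / \<epsilon>" "p > 0" using False pos by (simp_all add: p_def)
      then show ?thesis using False by (simp add: fermi_def p_def[symmetric]) (simp add: field_simps)
    qed
    ultimately show ?thesis by (simp add: right_diff_distrib)
  qed
  finally show ?thesis using False by (simp add: fermi_primitive_def)
qed

text \<open>
  The Pythagorean identity: integrated over $v$, the last term vanishes as soon as $x$ and $y$ give
  densities with equal moments and \<^term>\<open>ln y - ln z\<close> is a polynomial seen by these moments.
\<close>

lemma bregman_three_points:
  "bregman \<epsilon> x z =
     bregman \<epsilon> x y + bregman \<epsilon> y z + (fermi \<epsilon> x - fermi \<epsilon> y) * (ln y - ln z)"
  by (simp add: bregman_def algebra_simps)

text \<open>
  The comparison of the entropies rests on the factor $(1+\<epsilon> x)^{-2} \le 1$ here.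
\<close>

lemma DERIV_bregman:
  assumes "\<epsilon> \<ge> 0" "x > 0"
  shows "((\<lambda>x. bregman \<epsilon> x y) has_real_derivative (ln x - ln y) / (1 + \<epsilon> * x)\<^sup>2) (at x)"
proof -
  have pos: "1 + \<epsilon> * x > 0" using assms by (simp add: one_plus_pos)
  have "(fermi \<epsilon> has_real_derivative 1 / (1 + \<epsilon> * x)\<^sup>2) (at x)"
    unfolding fermi_def[abs_def] using pos
    by (auto intro!: derivative_eq_intros simp: field_simps power2_eq_square)
  moreover have "(fermi_primitive \<epsilon> has_real_derivative 1 / (1 + \<epsilon> * x)) (at x)"
    unfolding fermi_primitive_def[abs_def] using pos
    by (cases "\<epsilon> = 0") (auto intro!: derivative_eq_intros)
  ultimately have "((\<lambda>x. bregman \<epsilon> x y) has_real_derivative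
      1 / (1 + \<epsilon> * x)\<^sup>2 * (ln x - ln y) + fermi \<epsilon> x * (1 / x) - 1 / (1 + \<epsilon> * x)) (at x)"
    unfolding bregman_def using assms by (auto intro!: derivative_eq_intros)
  moreover have "fermi \<epsilon> x * (1 / x) = 1 / (1 + \<epsilon> * x)"
    using assms by (simp add: fermi_def)
  ultimately show ?thesis by simp
qed

text \<open>
  A function whose derivative has the sign of \<^term>\<open>z - y\<close> is minimal at $y$.
\<close>

lemma nonneg_if_derivative_ln_diff:
  fixes k c :: "real \<Rightarrow> real"
  assumes "x > 0" "y > 0" "k y = 0"
    and "\<And>z. z > 0 \<Longrightarrow> (k has_real_derivative (ln z - ln y) * c z) (at z)"
    and "\<And>z. z > 0 \<Longrightarrow> c z \<ge> 0"
  shows "k x \<ge> 0"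
proof (cases "y \<le> x")
  case True
  have "k y \<le> k x"
    using True assms(2) by (intro DERIV_nonneg_imp_nondecreasing[OF True])
      (metis assms(4,5) diff_ge_0_iff_ge ln_le_cancel_iff mult_nonneg_nonneg order_less_le_trans)
  then show ?thesis using assms by simp
next
  case False
  then have "x \<le> y" by simp
  have "k y \<le> k x"
  proof (rule DERIV_nonpos_imp_nonincreasing[OF \<open>x \<le> y\<close>])
    fix z assume z: "x \<le> z" "z \<le> y"
    then have "(ln z - ln y) * c z \<le> 0"
      using assms(1,2,5) by (intro mult_nonpos_nonneg) auto
    then show "\<exists>D. (k has_real_derivative D) (at z) \<and> D \<le> 0"
      using assms(1,4) z by (intro exI conjI) auto
  qed
  then show ?thesis using assms by simp
qed

lemma bregman_nonneg:
  assumes "\<epsilon> \<ge> 0" "x \<ge> 0" "y > 0"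
  shows "bregman \<epsilon> x y \<ge> 0"
proof (cases "x = 0")
  case True
  then show ?thesis
    using fermi_primitive_bounds(1)[of \<epsilon> y] assms
    by (simp add: bregman_def fermi_def fermi_primitive_def split: if_splits)
next
  case False
  then show ?thesis
    using assms DERIV_bregman[OF assms(1), of _ y]
    by (intro nonneg_if_derivative_ln_diff[where k = "\<lambda>x. bregman \<epsilon> x y" and x = x
          and c = "\<lambda>z. 1 / (1 + \<epsilon> * z)\<^sup>2" and y = y])
      (simp_all add: bregman_def)
qed

text \<open>
  The difference of the two sides has derivative $(\log x - \log y)(1 - (1+\<epsilon> x)^{-2})$ in $x$.
\<close>

lemma bregman_le_boltzmann:
  assumes "\<epsilon> \<ge> 0" "x \<ge> 0" "y > 0"
  shows "bregman \<epsilon> x y \<le> bregman 0 x y"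
proof (cases "x = 0")
  case True
  then show ?thesis
    using fermi_primitive_bounds(2)[of \<epsilon> y] assms
    by (simp add: bregman_def fermi_def fermi_primitive_def split: if_splits)
next
  case False
  have "0 \<le> bregman 0 x y - bregman \<epsilon> x y"
  proof (rule nonneg_if_derivative_ln_diff[where c = "\<lambda>z. 1 - 1 / (1 + \<epsilon> * z)\<^sup>2"
        and k = "\<lambda>x. bregman 0 x y - bregman \<epsilon> x y" and x = x and y = y])
    fix z :: real assume "z > 0"
    then show "((\<lambda>x. bregman 0 x y - bregman \<epsilon> x y) has_real_derivative
        (ln z - ln y) * (1 - 1 / (1 + \<epsilon> * z)\<^sup>2)) (at z)"
      using DERIV_bregman[of 0 z y] DERIV_bregman[of \<epsilon> z y] assms
      by (auto intro!: derivative_eq_intros simp: right_diff_distrib)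
    have "1 \<le> (1 + \<epsilon> * z)\<^sup>2" using \<open>z > 0\<close> assms by (simp add: one_le_power)
    then show "0 \<le> 1 - 1 / (1 + \<epsilon> * z)\<^sup>2"
      using divide_le_eq_1_pos[of "(1 + \<epsilon> * z)\<^sup>2" 1] by linarith
  qed (use False assms in \<open>auto simp: bregman_def\<close>)
  then show ?thesis by simp
qed

section \<open>Moments\<close>

lemma borel_measurable_lebesgueI: "h \<in> borel_measurable borel \<Longrightarrow> h \<in> borel_measurable lebesgue"
  by (simp add: measurable_completion)

lemma Lp_weighted_1_2_iff:
  "g \<in> Lp_weighted 1 2 \<longleftrightarrow>
     g \<in> borel_measurable lebesgue \<and> integrable lebesgue (\<lambda>v. g v * (1 + (norm v)\<^sup>2))"
proof (cases "g \<in> borel_measurable lebesgue")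
  case True
  note [measurable] = True
  have "\<bar>g v\<bar> powr 1 * (1 + (norm v)\<^sup>2) powr (1 * 2 / 2) = norm (g v * (1 + (norm v)\<^sup>2))" for v
    by (simp add: abs_mult add_nonneg_nonneg)
  moreover have "(\<lambda>v. g v * (1 + (norm v)\<^sup>2)) \<in> borel_measurable lebesgue"
    by (intro borel_measurable_times True borel_measurable_lebesgueI) measurable
  ultimately show ?thesis
    using True integrable_norm_iff[of "\<lambda>v. g v * (1 + (norm v)\<^sup>2)" lebesgue]
    by (simp add: Lp_weighted_def)
qed (simp add: Lp_weighted_def)

lemma Lp_weighted_1_2D:
  assumes "g \<in> Lp_weighted 1 2"
  shows "g \<in> borel_measurable lebesgue" "integrable lebesgue (\<lambda>v. g v * (1 + (norm v)\<^sup>2))"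
  using assms by (simp_all add: Lp_weighted_1_2_iff)

lemma Lp_weighted_1_2_dominated:
  assumes "g \<in> Lp_weighted 1 2" "h \<in> borel_measurable lebesgue"
    and "AE v in lebesgue. \<bar>h v\<bar> \<le> \<bar>g v\<bar>"
  shows "h \<in> Lp_weighted 1 2"
  unfolding Lp_weighted_1_2_iff
proof
  show "integrable lebesgue (\<lambda>v. h v * (1 + (norm v)\<^sup>2))"
  proof (rule Bochner_Integration.integrable_bound[OF Lp_weighted_1_2D(2)[OF assms(1)]])
    show "(\<lambda>v. h v * (1 + (norm v)\<^sup>2)) \<in> borel_measurable lebesgue"
      by (intro borel_measurable_times assms borel_measurable_lebesgueI) measurable
    show "AE v in lebesgue. norm (h v * (1 + (norm v)\<^sup>2)) \<le> norm (g v * (1 + (norm v)\<^sup>2))"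
      using assms(3) by eventually_elim (auto simp: abs_mult intro!: mult_right_mono)
  qed
qed fact

text \<open>
  Membership in $L^1_2$ is used through this lemma: all test functions that occur, scalar or vector
  valued, grow at most quadratically.
\<close>

lemma integrable_mult_quadratic_growth:
  fixes q :: "real^3 \<Rightarrow> 'b::euclidean_space"
  assumes "g \<in> Lp_weighted 1 2" "q \<in> borel_measurable borel"
    and "\<And>v. norm (q v) \<le> C * (1 + (norm v)\<^sup>2)"
  shows "integrable lebesgue (\<lambda>v. g v *\<^sub>R q v)"
proof (rule Bochner_Integration.integrable_bound)
  show "integrable lebesgue (\<lambda>v. C * (g v * (1 + (norm v)\<^sup>2)))"
    using Lp_weighted_1_2D[OF assms(1)] by simp
  show "(\<lambda>v. g v *\<^sub>R q v) \<in> borel_measurable lebesgue"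
    by (intro borel_measurable_scaleR borel_measurable_lebesgueI assms Lp_weighted_1_2D(1))
  have "norm (g v *\<^sub>R q v) \<le> norm (C * (g v * (1 + (norm v)\<^sup>2)))" for v
  proof -
    have "norm (q v) \<le> \<bar>C\<bar> * (1 + (norm v)\<^sup>2)"
      using assms(3)[of v] by (smt (verit) mult_right_mono zero_le_power2)
    then have "\<bar>g v\<bar> * norm (q v) \<le> \<bar>g v\<bar> * (\<bar>C\<bar> * (1 + (norm v)\<^sup>2))"
      by (rule mult_left_mono) simp
    also have "\<dots> = norm (C * (g v * (1 + (norm v)\<^sup>2)))"
      by (simp add: abs_mult)
    finally show ?thesis by simp
  qed
  then show "AE v in lebesgue. norm (g v *\<^sub>R q v) \<le> norm (C * (g v * (1 + (norm v)\<^sup>2)))"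
    by simp
qed

lemma integrable_moments:
  assumes "g \<in> Lp_weighted 1 2"
  shows "integrable lebesgue g" "integrable lebesgue (\<lambda>v. g v *\<^sub>R v)"
    "integrable lebesgue (\<lambda>v. g v * (norm v)\<^sup>2)"
proof -
  show "integrable lebesgue g"
    using integrable_mult_quadratic_growth[OF assms, of "\<lambda>_. 1::real" 1] by simp
  have "norm v \<le> 1 * (1 + (norm v)\<^sup>2)" for v :: "real^3"
    using zero_le_power2[of "norm v - 1"] by (simp add: power2_diff; smt (verit) norm_ge_zero)
  then show "integrable lebesgue (\<lambda>v. g v *\<^sub>R v)"
    using integrable_mult_quadratic_growth[OF assms, of "\<lambda>v. v" 1] by simp
  show "integrable lebesgue (\<lambda>v. g v * (norm v)\<^sup>2)"
    using integrable_mult_quadratic_growth[OF assms, of "\<lambda>v. (norm v)\<^sup>2" 1] by simp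
qed

lemma norm_diff_square: "(norm (v - u))\<^sup>2 = (norm v)\<^sup>2 - 2 * (u \<bullet> v) + (norm u)\<^sup>2"
  for u v :: "'a::real_inner"
  by (simp add: power2_norm_eq_inner algebra_simps inner_commute)

lemma has_integral_mult_quadratic:
  assumes "g \<in> Lp_weighted 1 2"
  shows "has_bochner_integral lebesgue (\<lambda>v. g v * (a + b * (norm (v - u))\<^sup>2))
     ((a + b * (norm u)\<^sup>2) * (LINT v|lebesgue. g v) - 2 * b * (u \<bullet> (LINT v|lebesgue. g v *\<^sub>R v))
        + b * (LINT v|lebesgue. g v * (norm v)\<^sup>2))"
proof -
  note int = integrable_moments[OF assms, THEN has_bochner_integral_integrable]
  have "g v * (a + b * (norm (v - u))\<^sup>2) =
      (a + b * (norm u)\<^sup>2) * g v - 2 * b * (u \<bullet> (g v *\<^sub>R v)) + b * (g v * (norm v)\<^sup>2)" for v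
    by (simp add: norm_diff_square algebra_simps)
  then show ?thesis
    by (simp only:) (intro has_bochner_integral_add has_bochner_integral_diff
      has_bochner_integral_mult_right has_bochner_integral_inner_right int)
qed

lemma integrable_mult_quadratic:
  "g \<in> Lp_weighted 1 2 \<Longrightarrow> integrable lebesgue (\<lambda>v. g v * (a + b * (norm (v - u))\<^sup>2))"
  by (rule integrable.intros[OF has_integral_mult_quadratic])

text \<open>
  Equal moments are equal integrals against the logarithms of Gaussians.
\<close>

lemma same_moments_quadratic:
  assumes "f \<in> Lp_weighted 1 2" "g \<in> Lp_weighted 1 2" "same_moments f g"
  shows "(LINT v|lebesgue. f v * (a + b * (norm (v - u))\<^sup>2)) =
    (LINT v|lebesgue. g v * (a + b * (norm (v - u))\<^sup>2))"
  using assms(3) has_integral_mult_quadratic[OF assms(1), of a b u, THEN has_bochner_integral_integral_eq]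
    has_integral_mult_quadratic[OF assms(2), of a b u, THEN has_bochner_integral_integral_eq]
  by (simp add: same_moments_def)

lemma same_moments_cong_AE:
  assumes "f \<in> borel_measurable lebesgue" "g \<in> borel_measurable lebesgue"
    and "AE v in lebesgue. f v = g v"
  shows "same_moments h f \<longleftrightarrow> same_moments h g"
proof -
  have "(LINT v|lebesgue. f v) = (LINT v|lebesgue. g v)"
    by (intro integral_cong_AE assms)
  moreover have "(LINT v|lebesgue. f v *\<^sub>R v) = (LINT v|lebesgue. g v *\<^sub>R v)"
    using assms(3)
    by (intro integral_cong_AE borel_measurable_scaleR borel_measurable_lebesgueI assms) auto
  moreover have "(LINT v|lebesgue. f v * (norm v)\<^sup>2) = (LINT v|lebesgue. g v * (norm v)\<^sup>2)"
    using assms(3)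
    by (intro integral_cong_AE borel_measurable_times borel_measurable_lebesgueI assms) auto
  ultimately show ?thesis by (simp add: same_moments_def)
qed

section \<open>Gaussians\<close>

text \<open>
  The image of an equilibrium under \<^term>\<open>\<phi> \<epsilon>\<close>; it does not depend on \<^term>\<open>\<epsilon>\<close>.
\<close>

definition gaussian :: "real \<Rightarrow> real \<Rightarrow> 'a::euclidean_space \<Rightarrow> 'a \<Rightarrow> real" where
  "gaussian a b u v = exp (a + b * (norm (v - u))\<^sup>2)"

lemma gaussian_pos: "gaussian a b u v > 0"
  by (simp add: gaussian_def)

lemma borel_measurable_gaussian [measurable]: "gaussian a b u \<in> borel_measurable borel"
  unfolding gaussian_def[abs_def] by measurable

lemma Fermi_Dirac_iff:
  "M \<in> Fermi_Dirac \<epsilon> \<longleftrightarrow> (\<exists>a b u. b < 0 \<and> M = (\<lambda>v. fermi \<epsilon> (gaussian a b u v)))"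
  by (simp add: Fermi_Dirac_def fermi_def gaussian_def)

lemma lebesgue_integral_affine:
  fixes h :: "'a::euclidean_space \<Rightarrow> 'b::{banach, second_countable_topology}"
  assumes "h \<in> borel_measurable borel" "s \<noteq> 0"
  shows "(LINT v|lebesgue. h v) = \<bar>s\<bar> ^ DIM('a) *\<^sub>R (LINT w|lebesgue. h (u + s *\<^sub>R w))"
proof -
  note [measurable] = assms(1)
  have "(LINT v|lborel. h v) = \<bar>s\<bar> ^ DIM('a) *\<^sub>R (LINT w|lborel. h (u + s *\<^sub>R w))"
    by (subst lborel_affine[OF assms(2), of u])
      (simp add: integral_density integral_distr)
  then show ?thesis by (simp add: integral_completion)
qed

lemma lebesgue_integrable_affine:
  fixes h :: "'a::euclidean_space \<Rightarrow> 'b::{banach, second_countable_topology}"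
  assumes "h \<in> borel_measurable borel" "s \<noteq> 0" "integrable lebesgue (\<lambda>w. h (u + s *\<^sub>R w))"
  shows "integrable lebesgue h"
proof -
  note [measurable] = assms(1)
  have "integrable lborel (\<lambda>w. h (u + s *\<^sub>R w))"
    using assms(3) by (simp add: integrable_completion)
  then have "integrable lborel h"
    by (subst lborel_affine[OF assms(2), of u])
      (simp add: integrable_density integrable_distr_eq)
  then show ?thesis by (simp add: integrable_completion)
qed

text \<open>
  The Gaussian is a product of one-dimensional Gaussians over the coordinates. The exponent is halved
  to leave room for the polynomial weight in the next lemma.
\<close>

lemma integrable_gaussian_half:
  "integrable lebesgue (\<lambda>w::'a::euclidean_space. exp (- (norm w)\<^sup>2 / 2))"
proof -
  have "integrable lborel (\<lambda>w::'a. exp (- (norm w)\<^sup>2 / 2))"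
    unfolding integrable_iff_bounded
  proof
    have one: "(\<integral>\<^sup>+x. ennreal (exp (- x\<^sup>2 / 2)) \<partial>(lborel :: real measure)) < \<infinity>"
    proof -
      have "integrable lborel (\<lambda>x::real. sqrt (2 * pi) * std_normal_density x)"
        by simp
      then have "integrable lborel (\<lambda>x::real. exp (- x\<^sup>2 / 2))"
        by (simp add: std_normal_density_def)
      then show ?thesis by (simp add: integrable_iff_bounded)
    qed
    have "exp (- (norm w)\<^sup>2 / 2) = (\<Prod>b\<in>Basis. exp (- (w \<bullet> b)\<^sup>2 / 2))" for w :: 'a
    proof -
      have "- (norm w)\<^sup>2 / 2 = (\<Sum>b\<in>Basis. - (w \<bullet> b)\<^sup>2 / 2)"
        unfolding power2_norm_eq_inner euclidean_inner[of w w]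
        by (simp add: power2_eq_square sum_divide_distrib sum_negf)
      then show ?thesis by (simp add: exp_sum)
    qed
    then have "(\<integral>\<^sup>+w. ennreal (norm (exp (- (norm w)\<^sup>2 / 2))) \<partial>(lborel :: 'a measure)) =
        (\<integral>\<^sup>+w. (\<Prod>b\<in>Basis. ennreal (exp (- (w \<bullet> b)\<^sup>2 / 2))) \<partial>(lborel :: 'a measure))"
      by (simp add: prod_ennreal abs_prod)
    also have "\<dots> = (\<Prod>b\<in>(Basis::'a set). (\<integral>\<^sup>+x. ennreal (exp (- x\<^sup>2 / 2)) \<partial>(lborel :: real measure)))"
      by (rule nn_integral_lborel_prod) simp_all
    also have "\<dots> < \<infinity>"
      using one by (simp add: power_less_top_ennreal)
    finally show "(\<integral>\<^sup>+w. ennreal (norm (exp (- (norm w)\<^sup>2 / 2))) \<partial>(lborel :: 'a measure)) < \<infinity>" .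
  qed measurable
  then show ?thesis by (simp add: integrable_completion)
qed

lemma integrable_gaussian_moment:
  "integrable lebesgue (\<lambda>w::'a::euclidean_space. exp (- (norm w)\<^sup>2) * (1 + (norm w)\<^sup>2))"
proof (rule Bochner_Integration.integrable_bound)
  show "integrable lebesgue (\<lambda>w::'a. 2 * exp (- (norm w)\<^sup>2 / 2))"
    using integrable_gaussian_half by simp
  have "exp (- t) * (1 + t) \<le> 2 * exp (- t / 2)" if "t \<ge> 0" for t :: real
  proof -
    have "1 + t \<le> 2 * exp (t / 2)"
      using exp_ge_add_one_self[of "t / 2"] that by linarith
    then have "exp (- t) * (1 + t) \<le> exp (- t) * (2 * exp (t / 2))"
      by (rule mult_left_mono) simp
    also have "\<dots> = 2 * exp (- t / 2)" by (simp add: exp_add[symmetric])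
    finally show ?thesis .
  qed
  then show "AE w::'a in lebesgue. norm (exp (- (norm w)\<^sup>2) * (1 + (norm w)\<^sup>2))
      \<le> norm (2 * exp (- (norm w)\<^sup>2 / 2))"
    by (simp add: abs_mult)
qed (intro borel_measurable_lebesgueI, measurable)

lemma gaussian_Lp_weighted:
  fixes u :: "real^3"
  assumes "b < 0"
  shows "gaussian a b u \<in> Lp_weighted 1 2"
  unfolding Lp_weighted_1_2_iff
proof
  show "gaussian a b u \<in> borel_measurable lebesgue"
    by (intro borel_measurable_lebesgueI borel_measurable_gaussian)
  define s where "s = 1 / sqrt (- b)"
  have s: "s > 0" "b * s\<^sup>2 = -1"
    using assms by (simp_all add: s_def power_divide)
  define C where "C = 1 + 2 * (norm u)\<^sup>2 + 2 * s\<^sup>2"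
  show "integrable lebesgue (\<lambda>v. gaussian a b u v * (1 + (norm v)\<^sup>2))"
  proof (rule lebesgue_integrable_affine[where u = u and s = s])
    show "integrable lebesgue (\<lambda>w. gaussian a b u (u + s *\<^sub>R w) * (1 + (norm (u + s *\<^sub>R w))\<^sup>2))"
    proof (rule Bochner_Integration.integrable_bound)
      show "integrable lebesgue (\<lambda>w::real^3. exp a * C * (exp (- (norm w)\<^sup>2) * (1 + (norm w)\<^sup>2)))"
        using integrable_gaussian_moment[where 'a = "real^3"] by simp
      have eq: "gaussian a b u (u + s *\<^sub>R w) = exp a * exp (- (norm w)\<^sup>2)" for w
        using s by (simp add: gaussian_def power_mult_distrib mult.assoc[symmetric] exp_add[symmetric])
      have "1 + (norm (u + s *\<^sub>R w))\<^sup>2 \<le> C * (1 + (norm w)\<^sup>2)" for w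
      proof -
        have "(norm (u + s *\<^sub>R w))\<^sup>2 \<le> (norm u + s * norm w)\<^sup>2"
          using norm_triangle_ineq[of u "s *\<^sub>R w"] s by (intro power_mono) auto
        also have "\<dots> \<le> 2 * (norm u)\<^sup>2 + 2 * (s\<^sup>2 * (norm w)\<^sup>2)"
          using sum_squares_bound[of "norm u" "s * norm w"]
          by (simp add: power2_sum power_mult_distrib)
        finally show ?thesis
          using mult_nonneg_nonneg[OF zero_le_power2 zero_le_power2, of "norm u" "norm w"]
            zero_le_power2[of s] zero_le_power2[of "norm w"]
          by (simp only: C_def algebra_simps)
      qed
      then have "exp a * exp (- (norm w)\<^sup>2) * (1 + (norm (u + s *\<^sub>R w))\<^sup>2) \<le>
          exp a * exp (- (norm w)\<^sup>2) * (C * (1 + (norm w)\<^sup>2))" for w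
        by (intro mult_left_mono) auto
      moreover have "C \<ge> 0" by (simp add: C_def)
      ultimately show "AE w in lebesgue. norm (gaussian a b u (u + s *\<^sub>R w) * (1 + (norm (u + s *\<^sub>R w))\<^sup>2))
          \<le> norm (exp a * C * (exp (- (norm w)\<^sup>2) * (1 + (norm w)\<^sup>2)))"
        by (simp add: eq abs_mult mult.assoc mult.left_commute)
    qed (intro borel_measurable_lebesgueI, measurable)
  qed (use s in \<open>auto, measurable\<close>)
qed

text \<open>
  The logarithm of a Gaussian is quadratic, so its entropy is controlled by its moments.
\<close>

lemma gaussian_LlogL:
  fixes u :: "real^3"
  assumes "b < 0"
  shows "gaussian a b u \<in> LlogL"
  using integrable_mult_quadratic[OF gaussian_Lp_weighted[OF assms, of a u], of a b u]
  by (simp add: LlogL_def borel_measurable_lebesgueI) (simp add: gaussian_def)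

section \<open>Entropy as a Bregman divergence\<close>

text \<open>
  Besides the formula, integrability is the point, because an integral that does not exist has the
  value 0. Both terms are dominated by their counterparts for $\<epsilon> = 0$, since
  $x/(1+\<epsilon> x) \le x$ and $\log(1+\<epsilon> x)/\<epsilon> \le x$.
\<close>

lemma entropy_fermi:
  assumes "\<epsilon> \<ge> 0" "g \<in> Lp_weighted 1 2 \<inter> LlogL" "AE v in lebesgue. g v \<ge> 0"
    and f: "AE v in lebesgue. f v = fermi \<epsilon> (g v)"
  shows "integrable lebesgue (\<lambda>v. fermi \<epsilon> (g v) * ln (g v) - fermi_primitive \<epsilon> (g v))" (is ?int)
    and "entropy \<epsilon> f = (LINT v|lebesgue. fermi \<epsilon> (g v) * ln (g v) - fermi_primitive \<epsilon> (g v))" (is ?eq)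
proof -
  have [measurable]: "g \<in> borel_measurable lebesgue"
    and mom: "g \<in> Lp_weighted 1 2" and log: "integrable lebesgue (\<lambda>v. g v * ln \<bar>g v\<bar>)"
    using assms(2) by (auto simp: Lp_weighted_1_2_iff LlogL_def)
  have "integrable lebesgue (\<lambda>v. fermi \<epsilon> (g v) * ln (g v))"
  proof (rule Bochner_Integration.integrable_bound[OF log])
    show "AE v in lebesgue. norm (fermi \<epsilon> (g v) * ln (g v)) \<le> norm (g v * ln \<bar>g v\<bar>)"
      using assms(3)
    proof eventually_elim
      case (elim v)
      then show ?case
        using fermi_le_self[OF assms(1) elim] fermi_nonneg[OF assms(1) elim]
        by (auto simp: abs_mult intro!: mult_right_mono)
    qed
  qed measurable
  moreover have "integrable lebesgue (\<lambda>v. fermi_primitive \<epsilon> (g v))"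
  proof (rule Bochner_Integration.integrable_bound[OF integrable_moments(1)[OF mom]])
    show "AE v in lebesgue. norm (fermi_primitive \<epsilon> (g v)) \<le> norm (g v)"
      using assms(3) by eventually_elim (use fermi_primitive_bounds[OF assms(1)] in fastforce)
  qed measurable
  ultimately show ?int by (rule Bochner_Integration.integrable_diff)
  have ae: "AE v in lebesgue. fermi \<epsilon> (g v) * ln (g v) - fermi_primitive \<epsilon> (g v) = \<Phi> \<epsilon> (f v)"
    using assms(3) f by eventually_elim (simp add: Phi_fermi[OF assms(1)])
  \<comment> \<open>Outside a null set the argument may leave the domain of the entropy function; completeness of the
    Lebesgue measure makes the composition measurable nevertheless.\<close>
  have "(\<lambda>v. \<Phi> \<epsilon> (f v)) \<in> borel_measurable lebesgue"
    by (rule borel_measurable_AE[OF borel_measurable_integrable[OF \<open>?int\<close>] ae])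
  then show ?eq
    unfolding entropy_def using ae borel_measurable_integrable[OF \<open>?int\<close>]
    by (intro integral_cong_AE) (auto elim: AE_mp)
qed

lemma fermi_Lp_weighted:
  assumes "\<epsilon> \<ge> 0" "g \<in> Lp_weighted 1 2" "AE v in lebesgue. g v \<ge> 0"
  shows "(\<lambda>v. fermi \<epsilon> (g v)) \<in> Lp_weighted 1 2"
proof (rule Lp_weighted_1_2_dominated[OF assms(2)])
  note [measurable] = Lp_weighted_1_2D(1)[OF assms(2)]
  show "(\<lambda>v. fermi \<epsilon> (g v)) \<in> borel_measurable lebesgue" by measurable
  show "AE v in lebesgue. \<bar>fermi \<epsilon> (g v)\<bar> \<le> \<bar>g v\<bar>"
    using assms(3) by eventually_elim (simp add: fermi_nonneg fermi_le_self assms(1))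
qed

text \<open>
  The divergence differs from the difference of the entropy densities by the linear term
  $\log m \cdot (f - m/(1+\<epsilon> m))$, whose integral vanishes because $\log m$ is quadratic and the
  moments agree.
\<close>

lemma relative_entropy_eq_bregman:
  assumes "\<epsilon> \<ge> 0" "b < 0" "g \<in> Lp_weighted 1 2 \<inter> LlogL" "AE v in lebesgue. g v \<ge> 0"
    and f: "AE v in lebesgue. f v = fermi \<epsilon> (g v)" "f \<in> borel_measurable lebesgue"
    and mom: "same_moments (\<lambda>v. fermi \<epsilon> (gaussian a b u v)) f"
  shows "integrable lebesgue (\<lambda>v. bregman \<epsilon> (g v) (gaussian a b u v))" (is ?int)
    and "relative_entropy \<epsilon> f (\<lambda>v. fermi \<epsilon> (gaussian a b u v)) =
      (LINT v|lebesgue. bregman \<epsilon> (g v) (gaussian a b u v))" (is ?eq)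
proof -
  let ?m = "gaussian a b u" and ?q = "\<lambda>v. a + b * (norm (v - u))\<^sup>2"
  let ?h = "\<lambda>x. fermi \<epsilon> x * ln x - fermi_primitive \<epsilon> x"
  have m: "?m \<in> Lp_weighted 1 2 \<inter> LlogL" "AE v in lebesgue. ?m v \<ge> 0"
    using assms(2) by (simp_all add: gaussian_Lp_weighted gaussian_LlogL gaussian_pos less_imp_le)
  have fg: "(\<lambda>v. fermi \<epsilon> (g v)) \<in> Lp_weighted 1 2" and fm: "(\<lambda>v. fermi \<epsilon> (?m v)) \<in> Lp_weighted 1 2"
    using fermi_Lp_weighted assms(1,3,4) m by auto
  have sm: "same_moments (\<lambda>v. fermi \<epsilon> (?m v)) (\<lambda>v. fermi \<epsilon> (g v))"
    using mom same_moments_cong_AE[OF f(2) Lp_weighted_1_2D(1)[OF fg] f(1)] by simp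
  note intg = entropy_fermi[OF assms(1,3,4) f(1)]
  note intm = entropy_fermi[OF assms(1) m AE_I2[OF refl]]
  note intq = integrable_mult_quadratic[OF fg, of a b u] integrable_mult_quadratic[OF fm, of a b u]
  have split: "bregman \<epsilon> (g v) (?m v) =
      ?h (g v) - ?h (?m v) - (fermi \<epsilon> (g v) * ?q v - fermi \<epsilon> (?m v) * ?q v)" for v
    by (simp add: bregman_def gaussian_def algebra_simps)
  show ?int
    unfolding split by (intro Bochner_Integration.integrable_diff[OF
        Bochner_Integration.integrable_diff[OF intg(1) intm(1)] Bochner_Integration.integrable_diff[OF intq]])
  have "(LINT v|lebesgue. bregman \<epsilon> (g v) (?m v)) =
      (LINT v|lebesgue. ?h (g v)) - (LINT v|lebesgue. ?h (?m v))"
    unfolding split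
    by (simp only: Bochner_Integration.integral_diff Bochner_Integration.integrable_diff
        intg(1) intm(1) intq same_moments_quadratic[OF fm fg sm] diff_self diff_zero)
  then show ?eq
    unfolding relative_entropy_def using intg(2) intm(2) by simp
qed

section \<open>Uniqueness of the equilibrium\<close>

lemma fermi_diff_mult_ln_diff_pos:
  assumes "\<epsilon> \<ge> 0" "x > 0" "y > 0" "x \<noteq> y"
  shows "(fermi \<epsilon> x - fermi \<epsilon> y) * (ln x - ln y) > 0"
proof (cases "x < y")
  case True
  then show ?thesis
    using assms strict_mono_fermi[of \<epsilon> x y] by (intro mult_neg_neg) auto
next
  case False
  then show ?thesis
    using assms strict_mono_fermi[of \<epsilon> y x] by (intro mult_pos_pos) auto
qed

text \<open>
  Let $m$ and $n$ be the Gaussians of $M$ and $N$. The function $(M-N)(\log m - \log n)$ is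
  nonnegative by monotonicity, and its integral vanishes because the second factor is a difference
  of quadratics. Hence $m = n$ almost everywhere, and everywhere by continuity.
\<close>

lemma Fermi_Dirac_unique:
  assumes "\<epsilon> \<ge> 0" "M \<in> Fermi_Dirac \<epsilon>" "N \<in> Fermi_Dirac \<epsilon>" "same_moments M N"
  shows "M = N"
proof -
  obtain a b u a' b' u' where b: "b < 0" "b' < 0"
    and M: "M = (\<lambda>v. fermi \<epsilon> (gaussian a b u v))"
    and N: "N = (\<lambda>v. fermi \<epsilon> (gaussian a' b' u' v))"
    using assms(2,3) by (auto simp: Fermi_Dirac_iff)
  let ?m = "gaussian a b u" and ?n = "gaussian a' b' u'"
  let ?q = "\<lambda>v. a + b * (norm (v - u))\<^sup>2" and ?r = "\<lambda>v. a' + b' * (norm (v - u'))\<^sup>2"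
  let ?D = "\<lambda>v. (M v - N v) * (ln (?m v) - ln (?n v))"
  have L: "M \<in> Lp_weighted 1 2" "N \<in> Lp_weighted 1 2"
    unfolding M N using b
    by (auto intro!: fermi_Lp_weighted gaussian_Lp_weighted AE_I2 less_imp_le gaussian_pos assms(1))
  note int = integrable_mult_quadratic[OF L(1)] integrable_mult_quadratic[OF L(2)]
  have D: "?D v = (M v * ?q v - N v * ?q v) - (M v * ?r v - N v * ?r v)" for v
    by (simp add: gaussian_def algebra_simps)
  have intD: "integrable lebesgue ?D"
    unfolding D by (intro Bochner_Integration.integrable_diff int)
  have "(LINT v|lebesgue. ?D v) = 0"
    unfolding D
    by (simp only: Bochner_Integration.integral_diff Bochner_Integration.integrable_diff
        int same_moments_quadratic[OF L assms(4)] diff_self)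
  moreover have nonneg: "?D v \<ge> 0" for v
    using fermi_diff_mult_ln_diff_pos[OF assms(1), of "?m v" "?n v"]
    by (cases "?m v = ?n v") (auto simp: M N gaussian_pos less_imp_le)
  ultimately have "AE v in lebesgue. ?D v = 0"
    using integral_nonneg_eq_0_iff_AE[OF intD] by simp
  then have "AE v in lebesgue. \<not> v \<in> {v. ?m v \<noteq> ?n v}"
  proof eventually_elim
    case (elim v)
    show ?case
    proof
      assume "v \<in> {v. ?m v \<noteq> ?n v}"
      then have "?D v > 0"
        unfolding M N by (intro fermi_diff_mult_ln_diff_pos assms(1) gaussian_pos) simp
      then show False using elim by (simp only: less_irrefl)
    qed
  qed
  moreover have op: "open {v. ?m v \<noteq> ?n v}"
    unfolding gaussian_def by (intro open_Collect_neq continuous_intros)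
  ultimately have "{v. ?m v \<noteq> ?n v} \<in> null_sets lebesgue"
    using AE_iff_null_sets[of "{v. ?m v \<noteq> ?n v}" lebesgue] by simp
  then have "{v. ?m v \<noteq> ?n v} = {}"
    using open_not_negligible[OF op] by (auto simp: negligible_iff_null_sets)
  then show ?thesis by (auto simp: M N)
qed

lemma equilibrium_works:
  assumes "\<epsilon> \<ge> 0" "M \<in> Fermi_Dirac \<epsilon>" "same_moments M f"
  shows "equilibrium \<epsilon> f \<in> Fermi_Dirac \<epsilon>" "same_moments (equilibrium \<epsilon> f) f"
proof -
  have "\<exists>!M. M \<in> Fermi_Dirac \<epsilon> \<and> same_moments M f"
  proof (rule ex1I[of _ M])
    fix N assume N: "N \<in> Fermi_Dirac \<epsilon> \<and> same_moments N f"
    then have "same_moments N M" using assms(3) by (simp add: same_moments_def)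
    then show "N = M" using N assms(1,2) by (blast intro: Fermi_Dirac_unique)
  qed (use assms in simp)
  from theI'[OF this]
  show "equilibrium \<epsilon> f \<in> Fermi_Dirac \<epsilon>" "same_moments (equilibrium \<epsilon> f) f"
    by (simp_all add: equilibrium_def)
qed

section \<open>Moments of the equilibrium profiles\<close>

text \<open>
  Moments of the centred equilibria with $b = -1$; every other equilibrium is a translation and
  dilation of one of these.
\<close>

definition profile_moment :: "real \<Rightarrow> nat \<Rightarrow> real \<Rightarrow> real" where
  "profile_moment \<epsilon> k a = (LINT w|lebesgue. fermi \<epsilon> (exp (a - (norm (w::real^3))\<^sup>2)) * norm w ^ k)"

text \<open>
  For \<^term>\<open>\<epsilon> > 0\<close>, dividing by \<^term>\<open>\<epsilon>\<close> gives the moments of the saturated state on the unit ball, the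
  limit of the equilibria at zero temperature.
\<close>

definition ball_moment :: "nat \<Rightarrow> real" where
  "ball_moment k = (LINT w|lebesgue. indicator (ball (0::real^3) 1) w * norm w ^ k)"

text \<open>
  In this form numerator and denominator stay bounded as $t \to \infty$.
\<close>

lemma fermi_exp: "fermi \<epsilon> (exp t) = 1 / (exp (- t) + \<epsilon>)" if "\<epsilon> \<ge> 0"
  using that by (simp add: fermi_def exp_minus field_simps add_pos_nonneg)

lemma integral_pos:
  fixes h :: "'a \<Rightarrow> real"
  assumes "integrable M h" "AE x in M. h x \<ge> 0" "\<not> (AE x in M. h x = 0)"
  shows "(LINT x|M. h x) > 0"
  using integral_nonneg_eq_0_iff_AE[OF assms(1,2)] integral_nonneg_AE[OF assms(2)] assms(3)
  by linarith

lemma AE_lebesgue_neq: "AE v in lebesgue. v \<noteq> (u :: 'a::euclidean_space)"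
  by (rule AE_completion[OF AE_lborel_singleton])

lemma not_AE_lebesgue_False: "\<not> (AE v in (lebesgue :: 'a::euclidean_space measure). False)"
  by (simp add: eventually_False Measure_Space.ae_filter_eq_bot_iff)

lemma power_le_one_plus_square: "t ^ k \<le> 1 + t\<^sup>2" if t: "t \<ge> 0" "k \<le> 2" for t :: real
proof -
  consider "k = 0" | "k = 1" | "k = 2" using t(2) by force
  then show ?thesis
  proof cases
    case 2
    have "0 \<le> (t - 1)\<^sup>2" by simp
    then show ?thesis using 2 t(1) by (simp add: power2_diff)
  qed simp_all
qed

text \<open>
  The common majorant for all applications of dominated convergence below.
\<close>

lemma gaussian_dominated_moment:
  fixes w :: "'a::euclidean_space"
  assumes "k \<le> 2" "0 \<le> p" "p \<le> C * exp (- (norm w)\<^sup>2)"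
  shows "norm (p * norm w ^ k) \<le> C * (exp (- (norm w)\<^sup>2) * (1 + (norm w)\<^sup>2))"
proof -
  have "p * norm w ^ k \<le> (C * exp (- (norm w)\<^sup>2)) * (1 + (norm w)\<^sup>2)"
    using assms by (intro mult_mono power_le_one_plus_square) auto
  then show ?thesis using assms by (simp add: mult.assoc)
qed

lemma profile_bound:
  fixes w :: "'a::euclidean_space"
  assumes "\<epsilon> \<ge> 0" "k \<le> 2" "a \<le> A"
  shows "norm (fermi \<epsilon> (exp (a - (norm w)\<^sup>2)) * norm w ^ k)
    \<le> exp A * (exp (- (norm w)\<^sup>2) * (1 + (norm w)\<^sup>2))"
proof (rule gaussian_dominated_moment[OF assms(2)])
  show "0 \<le> fermi \<epsilon> (exp (a - (norm w)\<^sup>2))"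
    using assms by (simp add: fermi_nonneg)
  have "fermi \<epsilon> (exp (a - (norm w)\<^sup>2)) \<le> exp (a - (norm w)\<^sup>2)"
    using assms by (simp add: fermi_le_self)
  also have "\<dots> \<le> exp A * exp (- (norm w)\<^sup>2)"
    using assms by (simp add: exp_add[symmetric])
  finally show "fermi \<epsilon> (exp (a - (norm w)\<^sup>2)) \<le> exp A * exp (- (norm w)\<^sup>2)" .
qed

lemma integrable_profile:
  assumes "\<epsilon> \<ge> 0" "k \<le> 2"
  shows "integrable lebesgue (\<lambda>w::real^3. fermi \<epsilon> (exp (a - (norm w)\<^sup>2)) * norm w ^ k)"
proof (rule Bochner_Integration.integrable_bound)
  show "integrable lebesgue (\<lambda>w::real^3. exp a * (exp (- (norm w)\<^sup>2) * (1 + (norm w)\<^sup>2)))"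
    using integrable_gaussian_moment[where 'a = "real^3"] by simp
  show "AE w::real^3 in lebesgue. norm (fermi \<epsilon> (exp (a - (norm w)\<^sup>2)) * norm w ^ k)
      \<le> norm (exp a * (exp (- (norm w)\<^sup>2) * (1 + (norm w)\<^sup>2)))"
    using profile_bound[OF assms order_refl] by (auto intro!: AE_I2 elim: order_trans)
qed (intro borel_measurable_lebesgueI, measurable)

lemma profile_moment_pos:
  assumes "\<epsilon> \<ge> 0" "k \<le> 2"
  shows "profile_moment \<epsilon> k a > 0"
  unfolding profile_moment_def
proof (rule integral_pos[OF integrable_profile[OF assms]])
  let ?h = "\<lambda>w::real^3. fermi \<epsilon> (exp (a - (norm w)\<^sup>2)) * norm w ^ k"
  show "AE w in lebesgue. ?h w \<ge> 0"
    using assms by (simp add: fermi_nonneg)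
  show "\<not> (AE w in lebesgue. ?h w = 0)"
  proof
    assume zero: "AE w in lebesgue. ?h w = 0"
    from zero AE_lebesgue_neq[of 0] have "AE w::real^3 in lebesgue. False"
    proof eventually_elim
      case (elim w)
      then show False
        using fermi_pos[OF assms(1), of "exp (a - (norm w)\<^sup>2)"] by simp
    qed
    then show False using not_AE_lebesgue_False by blast
  qed
qed

lemma isCont_profile_moment:
  assumes "\<epsilon> \<ge> 0" "k \<le> 2"
  shows "isCont (profile_moment \<epsilon> k) a"
  unfolding continuous_at_sequentially comp_def
proof (intro allI impI)
  fix X :: "nat \<Rightarrow> real" assume X: "X \<longlonglongrightarrow> a"
  obtain A where "\<And>n. norm (X n) \<le> A"
    using convergent_imp_Bseq[OF convergentI[OF X]] unfolding Bseq_def by blast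
  then have A: "X n \<le> A" for n by (simp add: abs_le_iff)
  show "(\<lambda>n. profile_moment \<epsilon> k (X n)) \<longlonglongrightarrow> profile_moment \<epsilon> k a"
    unfolding profile_moment_def
  proof (rule integral_dominated_convergence)
    show "integrable lebesgue (\<lambda>w::real^3. exp A * (exp (- (norm w)\<^sup>2) * (1 + (norm w)\<^sup>2)))"
      using integrable_gaussian_moment[where 'a = "real^3"] by simp
    show "AE w::real^3 in lebesgue. norm (fermi \<epsilon> (exp (X n - (norm w)\<^sup>2)) * norm w ^ k)
        \<le> exp A * (exp (- (norm w)\<^sup>2) * (1 + (norm w)\<^sup>2))" for n
      by (intro AE_I2 profile_bound assms A)
    have "exp (- t) + \<epsilon> \<noteq> 0" for t
      using assms(1) exp_gt_zero[of "- t"] by linarith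
    then show "AE w::real^3 in lebesgue. (\<lambda>n. fermi \<epsilon> (exp (X n - (norm w)\<^sup>2)) * norm w ^ k)
        \<longlonglongrightarrow> fermi \<epsilon> (exp (a - (norm w)\<^sup>2)) * norm w ^ k"
      unfolding fermi_exp[OF assms(1)] by (intro AE_I2 tendsto_intros X)
  qed (intro borel_measurable_lebesgueI, measurable)+
qed

lemma profile_moment_boltzmann: "profile_moment 0 k a = exp a * profile_moment 0 k 0"
proof -
  have "profile_moment 0 k a = (LINT w|lebesgue. exp a * (exp (- (norm (w::real^3))\<^sup>2) * norm w ^ k))"
    unfolding profile_moment_def by (simp add: exp_diff exp_minus divide_inverse mult.assoc)
  then show ?thesis by (simp add: profile_moment_def)
qed

lemma profile_moment_le_boltzmann:
  assumes "\<epsilon> \<ge> 0" "k \<le> 2"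
  shows "profile_moment \<epsilon> k a \<le> profile_moment 0 k a"
  unfolding profile_moment_def
  using assms by (intro integral_mono integrable_profile mult_right_mono) (auto simp: fermi_le_self)

text \<open>
  Together with the previous lemma: for $a \le 0$ the moments agree with those of the Maxwellian up
  to the factor $1+\<epsilon>$, so they inherit its behaviour as $a \to -\infty$.
\<close>

lemma profile_moment_ge_boltzmann:
  assumes "\<epsilon> \<ge> 0" "k \<le> 2" "a \<le> 0"
  shows "profile_moment 0 k a / (1 + \<epsilon>) \<le> profile_moment \<epsilon> k a"
proof -
  have "1 * exp (a - (norm w)\<^sup>2) / (1 + \<epsilon>) \<le> fermi \<epsilon> (exp (a - (norm w)\<^sup>2))" for w :: "real^3"
  proof -
    have "exp (a - (norm w)\<^sup>2) \<le> 1"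
      using order_trans[OF assms(3) zero_le_power2[of "norm w"]] by simp
    then have "1 + \<epsilon> * exp (a - (norm w)\<^sup>2) \<le> 1 + \<epsilon>"
      using assms(1) by (simp add: mult_left_le)
    then show ?thesis
      using assms(1) by (auto simp: fermi_def intro!: divide_left_mono mult_pos_pos one_plus_pos add_pos_nonneg)
  qed
  then have "(LINT w|lebesgue. fermi 0 (exp (a - (norm (w::real^3))\<^sup>2)) * norm w ^ k / (1 + \<epsilon>)) \<le>
      profile_moment \<epsilon> k a"
    unfolding profile_moment_def using assms
    by (intro integral_mono integrable_profile Bochner_Integration.integrable_divide)
      (auto simp: mult_right_mono simp flip: times_divide_eq_left)
  then show ?thesis by (simp add: profile_moment_def)
qed

section \<open>Energy compared with density\<close>

text \<open>
  At zero temperature the profile becomes a step function.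
\<close>

lemma tendsto_fermi_profile:
  assumes "\<epsilon> > 0" "c \<noteq> 0"
  shows "((\<lambda>a. fermi \<epsilon> (exp (a * c))) \<longlongrightarrow> (if c > 0 then 1 / \<epsilon> else 0)) at_top"
proof (cases "c > 0")
  case True
  have "filterlim (\<lambda>a. c * a) at_top at_top"
    using True by (rule filterlim_tendsto_pos_mult_at_top[OF tendsto_const _ filterlim_ident])
  then have "((\<lambda>a. exp (- (c * a))) \<longlongrightarrow> 0) at_top"
    by (intro filterlim_compose[OF exp_at_bot]) (simp add: filterlim_uminus_at_bot)
  then have "((\<lambda>a. 1 / (exp (- (c * a)) + \<epsilon>)) \<longlongrightarrow> 1 / (0 + \<epsilon>)) at_top"
    using assms by (intro tendsto_intros) auto
  then show ?thesis using True assms by (simp add: fermi_exp mult.commute)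
next
  case False
  then have "- c > 0" using assms by simp
  then have "filterlim (\<lambda>a. - c * a) at_top at_top"
    by (rule filterlim_tendsto_pos_mult_at_top[OF tendsto_const _ filterlim_ident])
  then have "((\<lambda>a. exp (a * c)) \<longlongrightarrow> 0) at_top"
    by (intro filterlim_compose[OF exp_at_bot])
      (simp add: filterlim_uminus_at_bot mult.commute)
  then have "((\<lambda>a. fermi \<epsilon> (exp (a * c))) \<longlongrightarrow> 0) at_top"
  proof (rule tendsto_sandwich[rotated 3])
    show "\<forall>\<^sub>F a in at_top. 0 \<le> fermi \<epsilon> (exp (a * c))"
      using assms by (simp add: fermi_nonneg)
    show "\<forall>\<^sub>F a in at_top. fermi \<epsilon> (exp (a * c)) \<le> exp (a * c)"
      using assms by (simp add: fermi_le_self)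
  qed (rule tendsto_const)
  then show ?thesis using False by simp
qed

lemma borel_measurable_ball_power:
  fixes u :: "'a::euclidean_space"
  shows "(\<lambda>v. indicator (ball u r) v * norm (v - u) ^ k :: real) \<in> borel_measurable borel"
  by (intro borel_measurable_times borel_measurable_indicator borel_open open_ball
      borel_measurable_continuous_onI continuous_intros)

text \<open>
  The profile is rescaled by $\sqrt a$, so that its edge stays on the unit sphere. Off this null set
  it converges to the saturated state.
\<close>

lemma tendsto_rescaled_profile_moment:
  assumes "\<epsilon> > 0" "k \<le> 2"
  shows "((\<lambda>a. LINT w|lebesgue. fermi \<epsilon> (exp (a * (1 - (norm (w::real^3))\<^sup>2))) * norm w ^ k)
    \<longlongrightarrow> ball_moment k / \<epsilon>) at_top"
proof -
  let ?s = "\<lambda>a w::real^3. fermi \<epsilon> (exp (a * (1 - (norm w)\<^sup>2))) * norm w ^ k"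
  let ?lim = "\<lambda>w::real^3. indicator (ball 0 1) w * norm w ^ k / \<epsilon>"
  let ?C = "(1 / \<epsilon> + 1) * exp 1"
  have "((\<lambda>a. LINT w|lebesgue. ?s a w) \<longlongrightarrow> (LINT w|lebesgue. ?lim w)) at_top"
  proof (rule integral_dominated_convergence_at_top)
    show "?lim \<in> borel_measurable lebesgue"
      using borel_measurable_ball_power[of "0::real^3" 1 k]
      by (intro borel_measurable_divide borel_measurable_lebesgueI) simp_all
    show "?s a \<in> borel_measurable lebesgue" for a
      by (intro borel_measurable_lebesgueI) measurable
    show "integrable lebesgue (\<lambda>w::real^3. ?C * (exp (- (norm w)\<^sup>2) * (1 + (norm w)\<^sup>2)))"
      using integrable_gaussian_moment[where 'a = "real^3"] by simp
    \<comment> \<open>Inside the unit ball the bound by $1/\<epsilon>$ is used, outside the bound by the Gaussian; for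
      $a \ge 1$ both lie below the majorant.\<close>
    have "norm (?s a w) \<le> ?C * (exp (- (norm w)\<^sup>2) * (1 + (norm w)\<^sup>2))" if "a \<ge> 1" for a w
    proof (rule gaussian_dominated_moment)
      define t where "t = (norm w)\<^sup>2"
      have "fermi \<epsilon> (exp (a * (1 - t))) \<le> (1 / \<epsilon> + 1) * exp (1 - t)"
      proof (cases "t \<le> 1")
        case True
        have "fermi \<epsilon> (exp (a * (1 - t))) \<le> 1 / \<epsilon> + 1"
          using fermi_le_inverse[OF assms(1), of "exp (a * (1 - t))"] by simp
        also have "\<dots> \<le> (1 / \<epsilon> + 1) * exp (1 - t)"
          using mult_left_mono[of 1 "exp (1 - t)" "1 / \<epsilon> + 1"] True assms by simp
        finally show ?thesis .
      next
        case False
        have "fermi \<epsilon> (exp (a * (1 - t))) \<le> exp (a * (1 - t))"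
          using assms by (simp add: fermi_le_self)
        also have "\<dots> \<le> exp (1 - t)"
          using False that by (simp add: mult_le_cancel_right1[of a "1 - t", simplified])
        also have "\<dots> \<le> (1 / \<epsilon> + 1) * exp (1 - t)"
          using assms by (simp add: mult_right_mono[of 1, simplified])
        finally show ?thesis .
      qed
      then show "fermi \<epsilon> (exp (a * (1 - (norm w)\<^sup>2))) \<le> ?C * exp (- (norm w)\<^sup>2)"
        by (simp add: t_def exp_diff exp_minus divide_inverse mult.assoc)
    qed (use assms in \<open>auto simp: fermi_nonneg\<close>)
    then show "\<forall>\<^sub>F a in at_top. AE w in lebesgue.
        norm (?s a w) \<le> ?C * (exp (- (norm w)\<^sup>2) * (1 + (norm w)\<^sup>2))"
      by (intro eventually_mono[OF eventually_ge_at_top[of 1]] AE_I2)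
    have "AE w::real^3 in lebesgue. w \<notin> sphere 0 1"
      using negligible_sphere[of "0::real^3" 1]
      by (intro AE_not_in) (simp add: negligible_iff_null_sets)
    then show "AE w in lebesgue. ((\<lambda>a. ?s a w) \<longlongrightarrow> ?lim w) at_top"
    proof eventually_elim
      case (elim w)
      then have "1 - (norm w)\<^sup>2 \<noteq> 0"
        using norm_ge_zero[of w] by (auto simp: power2_eq_1_iff simp del: norm_ge_zero)
      moreover have "1 - (norm w)\<^sup>2 > 0 \<longleftrightarrow> w \<in> ball 0 1"
        by (simp add: power_less_one_iff abs_square_less_1)
      ultimately show ?case
        using tendsto_mult_right[OF tendsto_fermi_profile[OF assms(1)], of "1 - (norm w)\<^sup>2" "norm w ^ k"]
        by (auto simp: indicator_def split: if_splits)
    qed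
  qed
  then show ?thesis by (simp add: ball_moment_def)
qed

lemma profile_moment_rescale:
  assumes "a > 0"
  shows "profile_moment \<epsilon> k a = sqrt a ^ (3 + k) *
    (LINT w|lebesgue. fermi \<epsilon> (exp (a * (1 - (norm (w::real^3))\<^sup>2))) * norm w ^ k)"
proof -
  have "profile_moment \<epsilon> k a = sqrt a ^ 3 *
      (LINT w|lebesgue. fermi \<epsilon> (exp (a - (norm (sqrt a *\<^sub>R (w::real^3)))\<^sup>2)) * norm (sqrt a *\<^sub>R w) ^ k)"
    unfolding profile_moment_def using assms
    by (subst lebesgue_integral_affine[of _ "sqrt a" 0]) auto
  also have "(LINT w|lebesgue. fermi \<epsilon> (exp (a - (norm (sqrt a *\<^sub>R (w::real^3)))\<^sup>2)) * norm (sqrt a *\<^sub>R w) ^ k)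
      = sqrt a ^ k * (LINT w|lebesgue. fermi \<epsilon> (exp (a * (1 - (norm (w::real^3))\<^sup>2))) * norm w ^ k)"
    using assms
    by (subst integral_mult_right_zero[symmetric])
      (auto simp: power_mult_distrib algebra_simps intro!: Bochner_Integration.integral_cong)
  finally show ?thesis by (simp add: power_add)
qed

lemma ball_moment_rescale:
  fixes u :: "real^3"
  assumes "r > 0"
  shows "(LINT v|lebesgue. indicator (ball u r) v * norm (v - u) ^ k) = r ^ (3 + k) * ball_moment k"
proof -
  have "(LINT v|lebesgue. indicator (ball u r) v * norm (v - u) ^ k) =
      r ^ 3 * (LINT w|lebesgue. indicator (ball u r) (u + r *\<^sub>R w) * norm (r *\<^sub>R (w::real^3)) ^ k)"
    using assms borel_measurable_ball_power[of u r k]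
    by (subst lebesgue_integral_affine[where s = r and u = u]) auto
  also have "(LINT w|lebesgue. indicator (ball u r) (u + r *\<^sub>R w) * norm (r *\<^sub>R (w::real^3)) ^ k)
      = (LINT w|lebesgue. r ^ k * (indicator (ball (0::real^3) 1) w * norm w ^ k))"
    using assms
    by (intro Bochner_Integration.integral_cong) (auto simp: power_mult_distrib indicator_def dist_norm)
  also have "\<dots> = r ^ k * ball_moment k"
    by (simp add: ball_moment_def)
  finally show ?thesis by (simp add: power_add)
qed

lemma integrable_ball_moment:
  fixes u :: "real^3"
  shows "integrable lebesgue (\<lambda>v. indicator (ball u r) v * norm (v - u) ^ k)"
proof (rule Bochner_Integration.integrable_bound)
  show "integrable lebesgue (\<lambda>v. r ^ k * indicator (ball u r) v :: real)"
    using emeasure_bounded_finite[of "ball u r"]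
    by (intro integrable_mult_right integrable_real_indicator) auto
  show "AE v in lebesgue. norm (indicator (ball u r) v * norm (v - u) ^ k)
      \<le> norm (r ^ k * indicator (ball u r) v :: real)"
    by (auto simp: indicator_def dist_norm norm_minus_commute power_abs
        intro!: AE_I2 power_mono)
qed (intro borel_measurable_lebesgueI borel_measurable_ball_power)

lemma ball_moment_pos: "ball_moment k > 0"
  unfolding ball_moment_def
proof (rule integral_pos)
  show "integrable lebesgue (\<lambda>w::real^3. indicator (ball 0 1) w * norm w ^ k)"
    using integrable_ball_moment[of 0 1 k] by simp
  show "\<not> (AE w::real^3 in lebesgue. indicator (ball 0 1) w * norm w ^ k = (0::real))"
  proof
    assume "AE w::real^3 in lebesgue. indicator (ball 0 1) w * norm w ^ k = (0::real)"
    with AE_lebesgue_neq[of 0] have "AE w::real^3 in lebesgue. w \<notin> ball 0 1"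
      by eventually_elim (auto simp: indicator_def)
    then have "negligible (ball (0::real^3) 1)"
      by (simp add: negligible_iff_null_sets AE_iff_null_sets)
    then show False using open_not_negligible[of "ball (0::real^3) 1"] by simp
  qed
qed simp

text \<open>
  The exponents 3 and 5 make the ratio invariant under dilations in dimension three, where density
  and energy scale like the third and fifth power of the length.
\<close>

lemma energy_ratio_attained:
  assumes "\<epsilon> \<ge> 0" "\<tau> > 0"
    and degenerate: "\<epsilon> > 0 \<Longrightarrow> (ball_moment 2 / \<epsilon>) ^ 3 / (ball_moment 0 / \<epsilon>) ^ 5 < \<tau>"
  shows "\<exists>a. profile_moment \<epsilon> 2 a ^ 3 = \<tau> * profile_moment \<epsilon> 0 a ^ 5"
proof -
  let ?R = "\<lambda>a. profile_moment \<epsilon> 2 a ^ 3 / profile_moment \<epsilon> 0 a ^ 5"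
  note pos = profile_moment_pos[OF assms(1)]
  define K0 K2 where "K0 = profile_moment 0 0 0" and "K2 = profile_moment 0 2 0"
  have K: "K0 > 0" "K2 > 0" by (simp_all add: K0_def K2_def profile_moment_pos)
  have exp_ratio: "(exp a * x) ^ 3 / (exp a * y) ^ 5 = exp (- (2 * a)) * (x ^ 3 / y ^ 5)" for a x y :: real
  proof -
    have "exp a ^ 5 = exp a ^ 3 * exp (2 * a)"
      by (simp add: exp_double flip: power_add)
    then show ?thesis
      by (simp add: power_mult_distrib exp_minus divide_inverse)
  qed
  have "\<exists>a. \<tau> \<le> ?R a"
  proof -
    \<comment> \<open>With $a = -X$ the ratio is at least $e^{2X}\,\tau / X$ and $e^{2X} \ge X$.\<close>
    define X where "X = \<tau> * (1 + \<epsilon>) ^ 3 * K0 ^ 5 / K2 ^ 3"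
    have X: "X > 0" using K assms by (simp add: X_def)
    have "\<tau> = X * ((K2 / (1 + \<epsilon>)) ^ 3 / K0 ^ 5)"
      using K assms by (simp add: X_def power_divide)
    also have "\<dots> \<le> exp (- (2 * (- X))) * ((K2 / (1 + \<epsilon>)) ^ 3 / K0 ^ 5)"
    proof (rule mult_right_mono)
      have "X \<le> exp (2 * X)" using exp_ge_add_one_self[of "2 * X"] X by linarith
      then show "X \<le> exp (- (2 * (- X)))" by simp
      show "0 \<le> (K2 / (1 + \<epsilon>)) ^ 3 / K0 ^ 5" using K assms by simp
    qed
    also have "\<dots> = (exp (- X) * (K2 / (1 + \<epsilon>))) ^ 3 / (exp (- X) * K0) ^ 5"
      by (rule exp_ratio[symmetric])
    also have "\<dots> \<le> ?R (- X)"
    proof (rule frac_le)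
      have "exp (- X) * (K2 / (1 + \<epsilon>)) \<le> profile_moment \<epsilon> 2 (- X)"
        using profile_moment_ge_boltzmann[OF assms(1), of 2 "- X"] X
          profile_moment_boltzmann[of 2 "- X"] by (simp add: K2_def)
      then show "(exp (- X) * (K2 / (1 + \<epsilon>))) ^ 3 \<le> profile_moment \<epsilon> 2 (- X) ^ 3"
        using K assms by (intro power_mono) auto
      have "profile_moment \<epsilon> 0 (- X) \<le> exp (- X) * K0"
        using profile_moment_le_boltzmann[OF assms(1), of 0 "- X"]
          profile_moment_boltzmann[of 0 "- X"] by (simp add: K0_def)
      then show "profile_moment \<epsilon> 0 (- X) ^ 5 \<le> (exp (- X) * K0) ^ 5"
        using pos[of 0] by (intro power_mono) (auto intro: less_imp_le)
    qed (use pos in \<open>auto intro: less_imp_le\<close>)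
    finally show ?thesis by blast
  qed
  then obtain a1 where a1: "\<tau> \<le> ?R a1" by blast
  have "\<exists>a. ?R a \<le> \<tau>"
  proof (cases "\<epsilon> = 0")
    case True
    \<comment> \<open>With $a = Y$ the ratio equals $e^{-2Y}\,Y\,\tau$.\<close>
    define Y where "Y = K2 ^ 3 / K0 ^ 5 / \<tau>"
    have Y: "Y > 0" using K assms by (simp add: Y_def)
    have "?R Y = exp (- (2 * Y)) * (K2 ^ 3 / K0 ^ 5)"
      unfolding True profile_moment_boltzmann[of _ Y] exp_ratio by (simp add: K0_def K2_def)
    also have "\<dots> = exp (- (2 * Y)) * Y * \<tau>"
      using assms by (simp add: Y_def)
    also have "exp (- (2 * Y)) * Y \<le> 1"
    proof -
      have "Y \<le> exp (2 * Y)" using exp_ge_add_one_self[of "2 * Y"] Y by linarith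
      then show ?thesis by (simp add: exp_minus field_simps)
    qed
    finally show ?thesis using assms(2) by (intro exI[of _ Y]) (auto simp: mult_right_mono)
  next
    case False
    then have eps: "\<epsilon> > 0" using assms by simp
    let ?J = "\<lambda>k a. LINT w|lebesgue. fermi \<epsilon> (exp (a * (1 - (norm (w::real^3))\<^sup>2))) * norm w ^ k"
    have "((\<lambda>a. ?J 2 a ^ 3 / ?J 0 a ^ 5) \<longlongrightarrow> (ball_moment 2 / \<epsilon>) ^ 3 / (ball_moment 0 / \<epsilon>) ^ 5) at_top"
      using ball_moment_pos[of 0] eps
      by (intro tendsto_intros tendsto_rescaled_profile_moment) auto
    then have "\<forall>\<^sub>F a in at_top. ?J 2 a ^ 3 / ?J 0 a ^ 5 < \<tau> \<and> a > 0"
      using order_tendstoD(2)[OF _ degenerate[OF eps]] eventually_gt_at_top[of 0]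
      by (intro eventually_conj) auto
    then obtain a where a: "?J 2 a ^ 3 / ?J 0 a ^ 5 < \<tau>" "a > 0"
      using eventually_happens by fastforce
    have "?R a = (sqrt a ^ 5 * ?J 2 a) ^ 3 / (sqrt a ^ 3 * ?J 0 a) ^ 5"
      using profile_moment_rescale[OF a(2), of \<epsilon> 2] profile_moment_rescale[OF a(2), of \<epsilon> 0]
      by simp
    also have "\<dots> = ?J 2 a ^ 3 / ?J 0 a ^ 5"
      using a(2) by (simp add: power_mult_distrib flip: power_mult)
    finally show ?thesis using a(1) by (intro exI[of _ a]) simp
  qed
  then obtain a2 where a2: "?R a2 \<le> \<tau>" by blast
  have "continuous_on UNIV ?R"
    using pos[of 0] isCont_profile_moment[OF assms(1)]
    by (intro continuous_at_imp_continuous_on ballI continuous_intros) (auto simp: less_imp_neq[symmetric])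
  then have "connected (range ?R)"
    by (rule connected_continuous_image) simp
  then have "\<tau> \<in> range ?R"
    using a1 a2 by (meson connectedD_interval rangeI)
  then obtain a where "?R a = \<tau>" by auto
  then show ?thesis using pos[of 0 a] by (intro exI[of _ a]) (simp add: field_simps)
qed

section \<open>Existence of the equilibrium\<close>

text \<open>
  The bathtub principle: among densities bounded by $1/\<epsilon>$, the least energy around $u$ for given
  mass is that of the saturated state on a ball of radius $r$ around $u$, because
  $(|v-u|^2 - r^2)(f - \<epsilon>^{-1}\mathbf 1_{B})\ge 0$. The strict bound $\<epsilon> f < 1$ makes the integrand
  positive in the ball, which yields the strict inequality.
\<close>

lemma energy_ratio_above_degenerate:
  fixes u :: "real^3"
  assumes "\<epsilon> > 0" "f \<in> Lp_weighted 1 2" "AE v in lebesgue. f v \<ge> 0"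
    and "AE v in lebesgue. 1 - \<epsilon> * f v > 0"
    and \<rho>: "\<rho> = (LINT v|lebesgue. f v)" "\<rho> > 0"
    and E: "E = (LINT v|lebesgue. f v * (norm (v - u))\<^sup>2)"
  shows "(ball_moment 2 / \<epsilon>) ^ 3 / (ball_moment 0 / \<epsilon>) ^ 5 < E ^ 3 / \<rho> ^ 5"
proof -
  define b where "b k = ball_moment k / \<epsilon>" for k
  have b: "b k > 0" for k using ball_moment_pos assms(1) by (simp add: b_def)
  \<comment> \<open>The radius at which the saturated state has mass \<rho>.\<close>
  define r where "r = root 3 (\<rho> / b 0)"
  have r: "r > 0" and r3: "r ^ 3 * b 0 = \<rho>"
    using \<rho> b[of 0] by (simp_all add: r_def)
  let ?\<chi> = "\<lambda>v. indicator (ball u r) v :: real"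
  let ?h = "\<lambda>v. ((norm (v - u))\<^sup>2 - r\<^sup>2) * (f v - ?\<chi> v / \<epsilon>)"
  have pos: "?h v > 0" if "v \<in> ball u r" "1 - \<epsilon> * f v > 0" for v
  proof (rule mult_neg_neg)
    show "(norm (v - u))\<^sup>2 - r\<^sup>2 < 0"
      using that r by (simp add: dist_norm norm_minus_commute power_strict_mono)
    show "f v - ?\<chi> v / \<epsilon> < 0"
      using that assms(1) by (simp add: field_simps)
  qed
  have int_f: "has_bochner_integral lebesgue (\<lambda>v. f v * (norm (v - u))\<^sup>2 - r\<^sup>2 * f v) (E - r\<^sup>2 * \<rho>)"
    unfolding E \<rho>(1)
    using integrable_mult_quadratic[OF assms(2), of 0 1 u] integrable_moments(1)[OF assms(2)]
    by (intro has_bochner_integral_diff has_bochner_integral_mult_right has_bochner_integral_integrable) auto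
  have int_ball: "has_bochner_integral lebesgue (\<lambda>v. ?\<chi> v * norm (v - u) ^ k) (r ^ (3 + k) * ball_moment k)" for k
    using ball_moment_rescale[OF r, of u k] integrable_ball_moment[of u r k]
    by (simp add: has_bochner_integral_iff)
  have "has_bochner_integral lebesgue
      (\<lambda>v. (f v * (norm (v - u))\<^sup>2 - r\<^sup>2 * f v)
         - (1 / \<epsilon> * (?\<chi> v * norm (v - u) ^ 2) - r\<^sup>2 / \<epsilon> * (?\<chi> v * norm (v - u) ^ 0)))
      (E - r\<^sup>2 * \<rho> - (1 / \<epsilon> * (r ^ (3 + 2) * ball_moment 2) - r\<^sup>2 / \<epsilon> * (r ^ (3 + 0) * ball_moment 0)))"
    by (intro has_bochner_integral_diff has_bochner_integral_mult_right int_f int_ball)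
  moreover have "(\<lambda>v. (f v * (norm (v - u))\<^sup>2 - r\<^sup>2 * f v)
         - (1 / \<epsilon> * (?\<chi> v * norm (v - u) ^ 2) - r\<^sup>2 / \<epsilon> * (?\<chi> v * norm (v - u) ^ 0))) = ?h"
    by (simp add: fun_eq_iff algebra_simps)
  moreover have "E - r\<^sup>2 * \<rho> - (1 / \<epsilon> * (r ^ (3 + 2) * ball_moment 2) - r\<^sup>2 / \<epsilon> * (r ^ (3 + 0) * ball_moment 0))
      = E - r ^ 5 * b 2"
    by (simp add: r3[symmetric] b_def)
  ultimately have h: "has_bochner_integral lebesgue ?h (E - r ^ 5 * b 2)" by metis
  have "(LINT v|lebesgue. ?h v) > 0"
  proof (rule integral_pos)
    show "integrable lebesgue ?h" using h by (rule integrable.intros)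
    show "AE v in lebesgue. ?h v \<ge> 0"
      using assms(3,4)
    proof eventually_elim
      case (elim v)
      show ?case
      proof (cases "v \<in> ball u r")
        case True
        then show ?thesis using pos elim by (auto intro: less_imp_le)
      next
        case False
        then have "r\<^sup>2 \<le> (norm (v - u))\<^sup>2"
          using r by (intro power_mono) (auto simp: dist_norm norm_minus_commute)
        then show ?thesis using False elim by simp
      qed
    qed
    show "\<not> (AE v in lebesgue. ?h v = 0)"
    proof
      assume "AE v in lebesgue. ?h v = 0"
      with assms(4) have "AE v in lebesgue. v \<notin> ball u r"
        by eventually_elim (use pos in force)
      then have "negligible (ball u r)"
        by (simp add: negligible_iff_null_sets AE_iff_null_sets)
      then show False using open_not_negligible[of "ball u r"] r by simp
    qed
  qed
  then have "r ^ 5 * b 2 < E" using has_bochner_integral_integral_eq[OF h] by simp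
  then have "(r ^ 5 * b 2) ^ 3 < E ^ 3"
    using r b[of 2] by (intro power_strict_mono) auto
  then have "(r ^ 5 * b 2) ^ 3 / \<rho> ^ 5 < E ^ 3 / \<rho> ^ 5"
    using \<rho>(2) by (simp add: divide_strict_right_mono)
  moreover have "(r ^ 5 * b 2) ^ 3 / \<rho> ^ 5 = b 2 ^ 3 / b 0 ^ 5"
    using r by (simp add: r3[symmetric] power_mult_distrib flip: power_mult)
  ultimately show ?thesis by (simp add: b_def)
qed

text \<open>
  Substitution $v = u + s w$; the first centred moment vanishes by the reflection $w \mapsto -w$.
\<close>

lemma Fermi_Dirac_scaled_moments:
  fixes u :: "real^3" and \<epsilon> a :: real
  assumes "s > 0"
  defines "M \<equiv> \<lambda>v. fermi \<epsilon> (gaussian a (- (1 / s\<^sup>2)) u v)"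
  shows "(LINT v|lebesgue. M v) = s ^ 3 * profile_moment \<epsilon> 0 a"
    and "(LINT v|lebesgue. M v *\<^sub>R (v - u)) = 0"
    and "(LINT v|lebesgue. M v * (norm (v - u))\<^sup>2) = s ^ 5 * profile_moment \<epsilon> 2 a"
proof -
  have [measurable]: "M \<in> borel_measurable borel" unfolding M_def by measurable
  have M: "M (u + s *\<^sub>R w) = fermi \<epsilon> (exp (a - (norm w)\<^sup>2))" for w
    using assms(1) by (simp add: M_def gaussian_def power_mult_distrib)
  show "(LINT v|lebesgue. M v) = s ^ 3 * profile_moment \<epsilon> 0 a"
    using assms(1) by (subst lebesgue_integral_affine[of _ s u]) (simp_all add: M profile_moment_def)
  have "(LINT v|lebesgue. M v * (norm (v - u))\<^sup>2) =
      s ^ 3 * (LINT w|lebesgue. s\<^sup>2 * (fermi \<epsilon> (exp (a - (norm (w::real^3))\<^sup>2)) * (norm w)\<^sup>2))"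
    using assms(1)
    by (subst lebesgue_integral_affine[of _ s u]) (simp_all add: M power_mult_distrib mult.left_commute)
  also have "\<dots> = s ^ 5 * profile_moment \<epsilon> 2 a"
    unfolding integral_mult_right_zero profile_moment_def by (simp add: power_add[symmetric, of s 3 2, simplified])
  finally show "(LINT v|lebesgue. M v * (norm (v - u))\<^sup>2) = s ^ 5 * profile_moment \<epsilon> 2 a" .
  have refl: "M (u - w) = M (u + w)" for w by (simp add: M_def gaussian_def)
  have "(LINT v|lebesgue. M v *\<^sub>R (v - u)) = - (LINT w|lebesgue. M (u + w) *\<^sub>R w)"
    by (subst lebesgue_integral_affine[of _ "-1" u]) (simp_all add: refl)
  also have "(LINT w|lebesgue. M (u + w) *\<^sub>R w) = (LINT v|lebesgue. M v *\<^sub>R (v - u))"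
    by (subst (2) lebesgue_integral_affine[of _ 1 u]) simp_all
  finally have "2 *\<^sub>R (LINT v|lebesgue. M v *\<^sub>R (v - u)) = 0"
    by (simp only: scaleR_2 eq_neg_iff_add_eq_0)
  then show "(LINT v|lebesgue. M v *\<^sub>R (v - u)) = 0" by simp
qed

lemma same_momentsI_centered:
  assumes "M \<in> Lp_weighted 1 2" "f \<in> Lp_weighted 1 2"
    and "(LINT v|lebesgue. M v) = (LINT v|lebesgue. f v)"
    and "(LINT v|lebesgue. M v *\<^sub>R (v - u)) = 0" "(LINT v|lebesgue. f v *\<^sub>R (v - u)) = 0"
    and "(LINT v|lebesgue. M v * (norm (v - u))\<^sup>2) = (LINT v|lebesgue. f v * (norm (v - u))\<^sup>2)"
  shows "same_moments M f"
proof -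
  have mean: "(LINT v|lebesgue. g v *\<^sub>R v) = (LINT v|lebesgue. g v *\<^sub>R (v - u)) + (LINT v|lebesgue. g v) *\<^sub>R u"
    if "g \<in> Lp_weighted 1 2" for g
    using integrable_moments[OF that] by (simp add: scaleR_diff_right)
  have "(LINT v|lebesgue. M v *\<^sub>R v) = (LINT v|lebesgue. f v *\<^sub>R v)"
    unfolding mean[OF assms(1)] mean[OF assms(2)] using assms(3-5) by simp
  then show ?thesis
    using has_integral_mult_quadratic[OF assms(1), of 0 1 u, THEN has_bochner_integral_integral_eq]
      has_integral_mult_quadratic[OF assms(2), of 0 1 u, THEN has_bochner_integral_integral_eq]
      assms(3,6)
    by (simp add: same_moments_def)
qed

text \<open>
  The free parameters are $u$, the mean velocity, the exponent $a$, which fixes the dilation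
  invariant ratio of energy and density, and the length $s$, which then matches both of them.
\<close>

lemma Fermi_Dirac_exists:
  assumes "\<epsilon> \<ge> 0" "f \<in> Lp_weighted 1 2" "AE v in lebesgue. f v \<ge> 0"
    and "\<not> (AE v in lebesgue. f v = 0)" "AE v in lebesgue. 1 - \<epsilon> * f v > 0"
  shows "\<exists>M \<in> Fermi_Dirac \<epsilon>. same_moments M f"
proof -
  note int = integrable_moments[OF assms(2)]
  define \<rho> where "\<rho> = (LINT v|lebesgue. f v)"
  have \<rho>: "\<rho> > 0" unfolding \<rho>_def by (rule integral_pos[OF int(1) assms(3,4)])
  define u where "u = (1 / \<rho>) *\<^sub>R (LINT v|lebesgue. f v *\<^sub>R v)"
  have centered: "(LINT v|lebesgue. f v *\<^sub>R (v - u)) = 0"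
    using int \<rho> by (simp add: scaleR_diff_right \<rho>_def[symmetric] u_def)
  define E where "E = (LINT v|lebesgue. f v * (norm (v - u))\<^sup>2)"
  have E: "E > 0"
    unfolding E_def
  proof (rule integral_pos)
    show "integrable lebesgue (\<lambda>v. f v * (norm (v - u))\<^sup>2)"
      using integrable_mult_quadratic[OF assms(2), of 0 1 u] by simp
    show "AE v in lebesgue. f v * (norm (v - u))\<^sup>2 \<ge> 0"
      using assms(3) by eventually_elim simp
    show "\<not> (AE v in lebesgue. f v * (norm (v - u))\<^sup>2 = 0)"
    proof
      assume "AE v in lebesgue. f v * (norm (v - u))\<^sup>2 = 0"
      with AE_lebesgue_neq[of u] have "AE v in lebesgue. f v = 0"
        by eventually_elim simp
      with assms(4) show False by simp
    qed
  qed
  have "\<exists>a. profile_moment \<epsilon> 2 a ^ 3 = (E ^ 3 / \<rho> ^ 5) * profile_moment \<epsilon> 0 a ^ 5"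
    using energy_ratio_above_degenerate[OF _ assms(2,3,5) \<rho>_def \<rho> E_def] \<rho> E assms(1)
    by (intro energy_ratio_attained) auto
  then obtain a where a: "profile_moment \<epsilon> 2 a ^ 3 = (E ^ 3 / \<rho> ^ 5) * profile_moment \<epsilon> 0 a ^ 5"
    by blast
  define I0 I2 where "I0 = profile_moment \<epsilon> 0 a" and "I2 = profile_moment \<epsilon> 2 a"
  have I: "I0 > 0" "I2 > 0" by (simp_all add: I0_def I2_def profile_moment_pos assms(1))
  have ratio: "I2 ^ 3 * \<rho> ^ 5 = E ^ 3 * I0 ^ 5"
    using a \<rho> by (simp add: I0_def I2_def field_simps)
  \<comment> \<open>Forced by the quotient $s^5 I_2 / (s^3 I_0) = E/\rho$ of the two equations to be solved.\<close>
  define s where "s = sqrt (E * I0 / (\<rho> * I2))"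
  have s: "s > 0" and s2: "s\<^sup>2 = E * I0 / (\<rho> * I2)"
    using I \<rho> E by (simp_all add: s_def)
  have density: "s ^ 3 * I0 = \<rho>"
  proof (rule power2_eq_imp_eq)
    have "(s ^ 3 * I0)\<^sup>2 = (s\<^sup>2) ^ 3 * I0\<^sup>2"
      by (simp add: power_mult_distrib flip: power_mult)
    also have "\<dots> = (E ^ 3 * I0 ^ 5) / (\<rho> ^ 3 * I2 ^ 3)"
      unfolding s2 by (simp add: power_divide power_mult_distrib mult.assoc flip: power_add)
    also have "\<dots> = \<rho>\<^sup>2"
      unfolding ratio[symmetric] using I \<rho> by (simp add: field_simps flip: power_add)
    finally show "(s ^ 3 * I0)\<^sup>2 = \<rho>\<^sup>2" .
  qed (use s I \<rho> in auto)
  have energy: "s ^ 5 * I2 = E"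
  proof -
    have "s ^ 5 * I2 = s\<^sup>2 * (s ^ 3 * I0) * I2 / I0"
      using I by (simp add: mult.assoc[symmetric] flip: power_add)
    also have "\<dots> = E"
      unfolding density s2 using I \<rho> by simp
    finally show ?thesis .
  qed
  let ?M = "\<lambda>v. fermi \<epsilon> (gaussian a (- (1 / s\<^sup>2)) u v)"
  have neg: "- (1 / s\<^sup>2) < 0" using s by simp
  then have FD: "?M \<in> Fermi_Dirac \<epsilon>" unfolding Fermi_Dirac_iff by blast
  have L: "?M \<in> Lp_weighted 1 2"
    by (intro fermi_Lp_weighted gaussian_Lp_weighted assms(1) neg AE_I2 less_imp_le gaussian_pos)
  have "same_moments ?M f"
    using Fermi_Dirac_scaled_moments[OF s, of \<epsilon> a u] density energy
    by (intro same_momentsI_centered[OF L assms(2) _ _ centered])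
      (simp_all add: I0_def I2_def \<rho>_def E_def)
  with FD show ?thesis by blast
qed

section \<open>Comparison of the relative entropies\<close>

text \<open>
  Among all Gaussians, that of the equilibrium with the moments of $f$ minimises the integrated
  divergence: by the three-point identity the difference is the integral of the nonnegative
  \<^term>\<open>bregman \<epsilon>\<close> between the two Gaussians.
\<close>

lemma relative_entropy_equilibrium_le:
  assumes "\<epsilon> \<ge> 0" "g \<in> Lp_weighted 1 2 \<inter> LlogL" "AE v in lebesgue. g v \<ge> 0"
    and f: "AE v in lebesgue. f v = fermi \<epsilon> (g v)" "f \<in> Lp_weighted 1 2"
    and M: "M \<in> Fermi_Dirac \<epsilon>" "same_moments M f"
    and int: "integrable lebesgue (\<lambda>v. bregman \<epsilon> (g v) (gaussian a b u v))"
  shows "relative_entropy \<epsilon> f M \<le> (LINT v|lebesgue. bregman \<epsilon> (g v) (gaussian a b u v))"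
proof -
  obtain a' b' u' where b': "b' < 0" and M_eq: "M = (\<lambda>v. fermi \<epsilon> (gaussian a' b' u' v))"
    using M(1) by (auto simp: Fermi_Dirac_iff)
  let ?m = "gaussian a b u" and ?\<mu> = "gaussian a' b' u'"
  let ?q = "\<lambda>v. a + b * (norm (v - u))\<^sup>2" and ?r = "\<lambda>v. a' + b' * (norm (v - u'))\<^sup>2"
  note rel = relative_entropy_eq_bregman[OF assms(1) b' assms(2,3) f(1)
      Lp_weighted_1_2D(1)[OF f(2)] M(2)[unfolded M_eq]]
  have L: "M \<in> Lp_weighted 1 2"
    unfolding M_eq using b'
    by (auto intro!: fermi_Lp_weighted gaussian_Lp_weighted AE_I2 less_imp_le gaussian_pos assms(1))
  note intq = integrable_mult_quadratic[OF L] integrable_mult_quadratic[OF f(2)]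
  \<comment> \<open>The integrated last term of the three-point identity.\<close>
  let ?c = "\<lambda>v. (f v * ?r v - M v * ?r v) - (f v * ?q v - M v * ?q v)"
  have intc: "integrable lebesgue ?c" "(LINT v|lebesgue. ?c v) = 0"
    by (simp_all only: Bochner_Integration.integral_diff Bochner_Integration.integrable_diff
        intq same_moments_quadratic[OF L f(2) M(2)] diff_self)
  have "(LINT v|lebesgue. bregman \<epsilon> (g v) (?\<mu> v) + ?c v) \<le> (LINT v|lebesgue. bregman \<epsilon> (g v) (?m v))"
  proof (rule integral_mono_AE[OF Bochner_Integration.integrable_add[OF rel(1) intc(1)] int])
    show "AE v in lebesgue. bregman \<epsilon> (g v) (?\<mu> v) + ?c v \<le> bregman \<epsilon> (g v) (?m v)"
      using f(1)
    proof eventually_elim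
      case (elim v)
      have "?c v = (fermi \<epsilon> (g v) - fermi \<epsilon> (?\<mu> v)) * (ln (?\<mu> v) - ln (?m v))"
        by (simp add: elim M_eq gaussian_def algebra_simps)
      moreover have "bregman \<epsilon> (?\<mu> v) (?m v) \<ge> 0"
        by (intro bregman_nonneg assms(1) less_imp_le gaussian_pos)
      ultimately show ?case
        using bregman_three_points[of \<epsilon> "g v" "?m v" "?\<mu> v"] by linarith
    qed
  qed
  then show ?thesis
    unfolding Bochner_Integration.integral_add[OF rel(1) intc(1)] intc(2)
    using rel(2) by (simp add: M_eq)
qed

theorem theorem1:
  fixes \<epsilon> :: real and f :: "real^3 \<Rightarrow> real"
  assumes "\<epsilon> > 0"
    and "f \<in> Lp_weighted 1 2"
    and "\<not> (AE v in lebesgue. f v = 0)"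
    and "AE v in lebesgue. f v \<ge> 0"
    and "AE v in lebesgue. 1 - \<epsilon> * f v > 0"
    and "(\<lambda>v. f v / (1 - \<epsilon> * f v)) \<in> Lp_weighted 1 2 \<inter> LlogL"
  shows "relative_entropy 0 (\<lambda>v. f v / (1 - \<epsilon> * f v)) (Maxwellian (\<lambda>v. f v / (1 - \<epsilon> * f v)))
           \<ge> relative_entropy \<epsilon> f (equilibrium \<epsilon> f)"
proof -
  define g where "g = (\<lambda>v. f v / (1 - \<epsilon> * f v))"
  have eps: "\<epsilon> \<ge> 0" using assms(1) by simp
  have g: "g \<in> Lp_weighted 1 2 \<inter> LlogL" and gL: "g \<in> Lp_weighted 1 2"
    using assms(6) by (auto simp: g_def)
  have g_nonneg: "AE v in lebesgue. g v \<ge> 0"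
    using assms(4,5) by eventually_elim (simp add: g_def)
  have fg: "AE v in lebesgue. f v = fermi \<epsilon> (g v)"
    using assms(5) by eventually_elim (simp add: g_def fermi_phi)
  have g_nonzero: "\<not> (AE v in lebesgue. g v = 0)"
  proof
    assume "AE v in lebesgue. g v = 0"
    with fg have "AE v in lebesgue. f v = 0" by eventually_elim (simp add: fermi_def)
    with assms(3) show False by simp
  qed
  obtain M where M: "M \<in> Fermi_Dirac \<epsilon>" "same_moments M f"
    using Fermi_Dirac_exists[OF eps assms(2,4,3,5)] by blast
  note eq = equilibrium_works[OF eps M]
  obtain N where N: "N \<in> Fermi_Dirac 0" "same_moments N g"
    using Fermi_Dirac_exists[OF order_refl gL g_nonneg g_nonzero] by auto
  note maxw = equilibrium_works[OF order_refl N, folded Maxwellian_def]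
  obtain a b u where b: "b < 0" and m: "Maxwellian g = (\<lambda>v. fermi 0 (gaussian a b u v))"
    using maxw(1) by (auto simp: Fermi_Dirac_iff)
  note boltzmann = relative_entropy_eq_bregman[OF order_refl b g g_nonneg AE_I2
      Lp_weighted_1_2D(1)[OF gL], simplified fermi_0, OF refl maxw(2)[unfolded m fermi_0]]
  have le: "AE v in lebesgue. bregman \<epsilon> (g v) (gaussian a b u v) \<le> bregman 0 (g v) (gaussian a b u v)"
    using g_nonneg by eventually_elim (intro bregman_le_boltzmann eps gaussian_pos)
  have [measurable]: "g \<in> borel_measurable lebesgue" using gL by (rule Lp_weighted_1_2D)
  have int: "integrable lebesgue (\<lambda>v. bregman \<epsilon> (g v) (gaussian a b u v))"
  proof (rule Bochner_Integration.integrable_bound[OF boltzmann(1)])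
    have "gaussian a b u \<in> borel_measurable lebesgue"
      by (intro borel_measurable_lebesgueI borel_measurable_gaussian)
    then show "(\<lambda>v. bregman \<epsilon> (g v) (gaussian a b u v)) \<in> borel_measurable lebesgue"
      unfolding bregman_def by measurable
    show "AE v in lebesgue. norm (bregman \<epsilon> (g v) (gaussian a b u v)) \<le> norm (bregman 0 (g v) (gaussian a b u v))"
      using le g_nonneg
    proof eventually_elim
      case (elim v)
      then show ?case using bregman_nonneg[OF eps elim(2) gaussian_pos, of a b u v] by simp
    qed
  qed
  have "relative_entropy \<epsilon> f (equilibrium \<epsilon> f) \<le> (LINT v|lebesgue. bregman \<epsilon> (g v) (gaussian a b u v))"
    by (rule relative_entropy_equilibrium_le[OF eps g g_nonneg fg assms(2) eq int])
  also have "\<dots> \<le> (LINT v|lebesgue. bregman 0 (g v) (gaussian a b u v))"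
    by (rule integral_mono_AE[OF int boltzmann(1) le])
  also have "\<dots> = relative_entropy 0 g (Maxwellian g)"
    using boltzmann(2) by (simp add: m)
  finally show ?thesis by (simp add: g_def)
qed

end
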